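(* Let ancillae $A_1,\dots,A_n$ ($n\ge2$) consecutively measure a $d$-dimensional prepared quantum system $Q$, and let detectors $D_1,\dots,D_n$ amplify them. Then $$S(D_n:D_{n-1}\cdots D_1)\le S(A_n:A_{n-1}\cdots A_1)-\Sigma_n,$$ where $\Sigma_n=S(A_{n-1}|A_n)\ge0$ (computed in the unamplified state), the left side being computed in the amplified state and $S(A_n:A_{n-1}\cdots A_1)$ in the unamplified state.
   Context: $Q$ is $d$-dimensional, initially in $|Q\rangle=\sum_{x_1}\alpha^{(1)}_{x_1}|\widetilde{x}_1\rangle$. Ancilla $A_i$ ($d$-dimensional, basis $\{|x\rangle\}$, initially $|0\rangle$) measures $Q$ in the orthonormal basis $\{|\widetilde{x}_i\rangle\}$ via $\sum_x|\widetilde{x}_i\rangle\langle\widetilde{x}_i|\otimes U_x$, $U_x|0\rangle=|x\rangle$; with unitary $U^{(i)}_{x_{i-1}x_i}=\langle\widetilde{x}_i|\widetilde{x}_{i-1}\rangle$ the unamplified state is $\sum_{x_1,\dots,x_n}\alpha^{(1)}_{x_1}U^{(2)}_{x_1x_2}\cdots U^{(n)}_{x_{n-1}x_n}|\widetilde{x}_n\rangle_Q|x_1\rangle_{A_1}\cdots|x_n\rangle_{A_n}$. Amplification: detector $D_i$ (initially $|0\rangle$) copies $A_i$, $|x\rangle_{A_i}|0\rangle_{D_i}\mapsto|x\rangle_{A_i}|x\rangle_{D_i}$. Entropies are von Neumann (log base $d$) of reduced states; $S(X|Y)=S(XY)-S(Y)$, $S(X:Y)=S(X)+S(Y)-S(XY)$.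 *)

theory Defs
  imports "Jordan_Normal_Form.Char_Poly"
begin

text \<open>Registers are numbered: position 0 is Q, position i (1 \<le> i \<le> n) is ancilla A_i,
 position n+i is detector D_i; total number of registers is 2n+1, each d-dimensional.
 A computational-basis configuration is a function from positions to digits.\<close>

text \<open>k-th basis configuration of the registers in the finite set X (mixed-radix digits,
 digit for the register of rank r in X is k div d^r mod d; 0 outside X).\<close>
definition enc :: "nat \<Rightarrow> nat set \<Rightarrow> nat \<Rightarrow> (nat \<Rightarrow> nat)" where
  "enc d X k = (\<lambda>p. if p \<in> X then k div d ^ card {q\<in>X. q < p} mod d else 0)"

definition reduced :: "nat \<Rightarrow> nat \<Rightarrow> ((nat \<Rightarrow> nat) \<Rightarrow> complex) \<Rightarrow> nat set \<Rightarrow> complex mat" where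
  "reduced d N psi X = (let Y = {0..<N} - X in
     mat (d ^ card X) (d ^ card X)
       (\<lambda>(i,j). \<Sum>k<d ^ card Y. psi (\<lambda>p. enc d X i p + enc d Y k p)
                      * cnj (psi (\<lambda>p. enc d X j p + enc d Y k p))))"

definition vn_entropy :: "nat \<Rightarrow> complex mat \<Rightarrow> real" where
  "vn_entropy d A = - (\<Sum>z\<in>{z. poly (char_poly A) z = 0}.
      real (order z (char_poly A)) * (Re z * log (real d) (Re z)))"

definition ent :: "nat \<Rightarrow> nat \<Rightarrow> ((nat \<Rightarrow> nat) \<Rightarrow> complex) \<Rightarrow> nat set \<Rightarrow> real" where
  "ent d N psi X = vn_entropy d (reduced d N psi X)"

definition cond_ent :: "nat \<Rightarrow> nat \<Rightarrow> ((nat \<Rightarrow> nat) \<Rightarrow> complex) \<Rightarrow> nat set \<Rightarrow> nat set \<Rightarrow> real" where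
  "cond_ent d N psi X Y = ent d N psi (X \<union> Y) - ent d N psi Y"

definition mutual_info :: "nat \<Rightarrow> nat \<Rightarrow> ((nat \<Rightarrow> nat) \<Rightarrow> complex) \<Rightarrow> nat set \<Rightarrow> nat set \<Rightarrow> real" where
  "mutual_info d N psi X Y = ent d N psi X + ent d N psi Y - ent d N psi (X \<union> Y)"

text \<open>b i x q: q-th computational component of the basis vector |x~_i>.
  U i x y = U^(i)_{xy} = <x~_i = y | x~_{i-1} = x>.\<close>
definition Umat :: "nat \<Rightarrow> (nat \<Rightarrow> nat \<Rightarrow> nat \<Rightarrow> complex) \<Rightarrow> nat \<Rightarrow> nat \<Rightarrow> nat \<Rightarrow> complex" where
  "Umat d b i x y = (\<Sum>q<d. cnj (b i y q) * b (i - 1) x q)"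

definition amp :: "nat \<Rightarrow> nat \<Rightarrow> (nat \<Rightarrow> complex) \<Rightarrow> (nat \<Rightarrow> nat \<Rightarrow> nat \<Rightarrow> complex) \<Rightarrow> (nat \<Rightarrow> nat) \<Rightarrow> complex" where
  "amp d n \<alpha> b c = \<alpha> (c 1) * (\<Prod>i\<in>{2..n}. Umat d b i (c (i - 1)) (c i)) * b n (c n) (c 0)"

definition unamplified :: "nat \<Rightarrow> nat \<Rightarrow> (nat \<Rightarrow> complex) \<Rightarrow> (nat \<Rightarrow> nat \<Rightarrow> nat \<Rightarrow> complex) \<Rightarrow> (nat \<Rightarrow> nat) \<Rightarrow> complex" where
  "unamplified d n \<alpha> b c = (if \<forall>i\<in>{1..n}. c (n + i) = 0 then amp d n \<alpha> b c else 0)"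

definition amplified :: "nat \<Rightarrow> nat \<Rightarrow> (nat \<Rightarrow> complex) \<Rightarrow> (nat \<Rightarrow> nat \<Rightarrow> nat \<Rightarrow> complex) \<Rightarrow> (nat \<Rightarrow> nat) \<Rightarrow> complex" where
  "amplified d n \<alpha> b c = (if \<forall>i\<in>{1..n}. c (n + i) = c i then amp d n \<alpha> b c else 0)"

end

theory Submission
  imports
    Defs
    "Jordan_Normal_Form.Schur_Decomposition"
    "HOL-Analysis.L2_Norm"
    "HOL-Library.Function_Algebras"
begin

text \<open>Let \<open>H(X)\<close> be the Shannon entropy of the outcomes of the measurements in \<open>X\<close>. A set of detectors is in a
  diagonal state, whose entropy is the corresponding \<open>H(X)\<close>. Since \<open>x\<^sub>n\<close> depends on the past only through
  \<open>x\<^sub>n\<^sub>-\<^sub>1\<close>, the left side is \<open>H(x\<^sub>n) - H(x\<^sub>n | x\<^sub>n\<^sub>-\<^sub>1)\<close>. In the unamplified state \<open>Q\<close> decoheres \<open>x\<^sub>n\<close>, so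
  \<open>A\<^sub>1 \<dots> A\<^sub>n\<close> carry one pure state per value of \<open>x\<^sub>n\<close> and have entropy \<open>H(x\<^sub>n)\<close>; likewise, by unitarity of the
  last basis change, \<open>A\<^sub>1 \<dots> A\<^sub>n\<^sub>-\<^sub>1\<close> have entropy \<open>H(x\<^sub>n\<^sub>-\<^sub>1)\<close>. The claim thus becomes
  \<open>S(A\<^sub>n\<^sub>-\<^sub>1A\<^sub>n) \<le> H(x\<^sub>n\<^sub>-\<^sub>1 x\<^sub>n)\<close>: a state has at most the entropy of its diagonal. The state of \<open>A\<^sub>n\<^sub>-\<^sub>1A\<^sub>n\<close> is block
  diagonal in \<open>x\<^sub>n\<close>, and the eigenvalues of a block are at most its trace, which gives
  \<open>S(A\<^sub>n\<^sub>-\<^sub>1A\<^sub>n) \<ge> H(x\<^sub>n) = S(A\<^sub>n)\<close>.\<close>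

section \<open>Hermitian kernels\<close>

text \<open>A kernel stands for the \<open>m \<times> m\<close> matrix of its values at indices below \<open>m\<close>; other values are ignored.\<close>

definition cinner :: "nat \<Rightarrow> (nat \<Rightarrow> complex) \<Rightarrow> (nat \<Rightarrow> complex) \<Rightarrow> complex" where
  "cinner m u v = (\<Sum>x<m. cnj (u x) * v x)"

definition orthonormal :: "nat \<Rightarrow> nat \<Rightarrow> (nat \<Rightarrow> nat \<Rightarrow> complex) \<Rightarrow> bool" where
  "orthonormal m r v \<longleftrightarrow> (\<forall>j<r. \<forall>k<r. cinner m (v j) (v k) = (if j = k then 1 else 0))"

definition kernel_apply :: "nat \<Rightarrow> (nat \<Rightarrow> nat \<Rightarrow> complex) \<Rightarrow> (nat \<Rightarrow> complex) \<Rightarrow> nat \<Rightarrow> complex" where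
  "kernel_apply m B u x = (\<Sum>y<m. B x y * u y)"

definition kernel_eigenvector :: "nat \<Rightarrow> (nat \<Rightarrow> nat \<Rightarrow> complex) \<Rightarrow> (nat \<Rightarrow> complex) \<Rightarrow> complex \<Rightarrow> bool" where
  "kernel_eigenvector m B u \<mu> \<longleftrightarrow> (\<forall>x<m. kernel_apply m B u x = \<mu> * u x)"

definition hermitian_kernel :: "nat \<Rightarrow> (nat \<Rightarrow> nat \<Rightarrow> complex) \<Rightarrow> bool" where
  "hermitian_kernel m B \<longleftrightarrow> (\<forall>x<m. \<forall>y<m. cnj (B x y) = B y x)"

lemma cinner_cnj: "cnj (cinner m u v) = cinner m v u"
  by (simp add: cinner_def mult.commute)

lemma cinner_self: "cinner m u u = of_real (\<Sum>x<m. (cmod (u x))\<^sup>2)"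
  by (simp add: cinner_def complex_norm_square mult.commute del: of_real_power)

lemma cinner_scale_right: "cinner m u (\<lambda>x. s * v x) = s * cinner m u v"
  by (simp add: cinner_def sum_distrib_left ac_simps)

lemma cinner_scale_left: "cinner m (\<lambda>x. s * u x) v = cnj s * cinner m u v"
  by (simp add: cinner_def sum_distrib_left ac_simps)

lemma cinner_cong: "(\<And>x. x < m \<Longrightarrow> u x = u' x) \<Longrightarrow> (\<And>x. x < m \<Longrightarrow> v x = v' x) \<Longrightarrow> cinner m u v = cinner m u' v'"
  by (simp add: cinner_def)

lemma cinner_eigenvector_right:
  assumes "kernel_eigenvector m B u \<mu>"
  shows "cinner m v (kernel_apply m B u) = \<mu> * cinner m v u"
  using assms by (simp add: kernel_eigenvector_def cinner_scale_right cong: cinner_cong)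

lemma cinner_eigenvector_left:
  assumes "kernel_eigenvector m B u \<mu>"
  shows "cinner m (kernel_apply m B u) v = cnj \<mu> * cinner m u v"
  using assms by (simp add: kernel_eigenvector_def cinner_scale_left cong: cinner_cong)

lemma cinner_hermitian_kernel:
  assumes "hermitian_kernel m B"
  shows "cinner m u (kernel_apply m B v) = cinner m (kernel_apply m B u) v"
proof -
  have herm: "cnj (B y x) = B x y" if "x < m" "y < m" for x y
    using assms that by (simp add: hermitian_kernel_def)
  have "cinner m u (kernel_apply m B v) = (\<Sum>y<m. \<Sum>x<m. cnj (u x) * B x y * v y)"
    unfolding cinner_def kernel_apply_def sum_distrib_left mult.assoc by (rule sum.swap)
  also have "\<dots> = (\<Sum>y<m. \<Sum>x<m. cnj (B y x) * cnj (u x) * v y)"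
    by (intro sum.cong refl) (simp add: herm)
  also have "\<dots> = cinner m (kernel_apply m B u) v"
    by (simp add: cinner_def kernel_apply_def sum_distrib_right)
  finally show ?thesis .
qed

lemma orthonormal_eq:
  assumes "orthonormal m r v" "j < r" "k < r"
  shows "cinner m (v j) (v k) = (if j = k then 1 else 0)"
  using assms by (simp add: orthonormal_def)

lemma orthonormal_sum_cmod:
  assumes "orthonormal m r v" "k < r"
  shows "(\<Sum>x<m. (cmod (v k x))\<^sup>2) = 1"
  using orthonormal_eq[OF assms(1,2,2)] cinner_self[of m "v k"] of_real_eq_1_iff by metis

lemma orthonormal_complete:
  assumes "orthonormal m m v" "x < m" "y < m"
  shows "(\<Sum>k<m. v k x * cnj (v k y)) = (if x = y then 1 else 0)"
proof -
  define V where "V = mat m m (\<lambda>(x, k). v k x)"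
  define W where "W = mat m m (\<lambda>(k, x). cnj (v k x))"
  have V: "V \<in> carrier_mat m m" and W: "W \<in> carrier_mat m m"
    by (auto simp: V_def W_def)
  have "W * V = 1\<^sub>m m"
    using assms(1)
    by (intro eq_matI) (auto simp: V_def W_def scalar_prod_def lessThan_atLeast0 orthonormal_def cinner_def)
  then have "V * W = 1\<^sub>m m"
    by (rule mat_mult_left_right_inverse[OF W V])
  then have "(V * W) $$ (x, y) = (1\<^sub>m m) $$ (x, y)"
    by simp
  then show ?thesis
    using assms(2,3) by (simp add: V_def W_def scalar_prod_def lessThan_atLeast0)
qed

lemma orthonormal_complete_sum_cmod:
  assumes "orthonormal m m v" "x < m"
  shows "(\<Sum>k<m. (cmod (v k x))\<^sup>2) = 1"
proof -
  have "complex_of_real (\<Sum>k<m. (cmod (v k x))\<^sup>2) = 1"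
    using orthonormal_complete[OF assms(1,2,2)] by (simp add: complex_norm_square del: of_real_power)
  then show ?thesis
    unfolding of_real_eq_1_iff .
qed

lemma orthonormal_parseval:
  assumes "orthonormal m m v"
  shows "(\<Sum>k<m. cinner m (v k) u * cnj (cinner m (v k) w)) = cinner m w u"
proof -
  have "(\<Sum>k<m. cinner m (v k) u * cnj (cinner m (v k) w))
    = (\<Sum>k<m. \<Sum>y<m. \<Sum>x<m. (cnj (w x) * u y) * (v k x * cnj (v k y)))"
    unfolding cinner_cnj unfolding cinner_def sum_product by (simp add: ac_simps)
  also have "\<dots> = (\<Sum>y<m. \<Sum>x<m. (cnj (w x) * u y) * (\<Sum>k<m. v k x * cnj (v k y)))"
    unfolding sum_distrib_left by (rule trans[OF sum.swap sum.cong[OF refl sum.swap]])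
  also have "\<dots> = (\<Sum>y<m. \<Sum>x<m. (cnj (w x) * u y) * (if x = y then 1 else 0))"
    by (intro sum.cong refl arg_cong2[where f="(*)"] orthonormal_complete[OF assms]) auto
  also have "\<dots> = cinner m w u"
    by (simp add: cinner_def if_distrib cong: if_cong)
  finally show ?thesis .
qed

lemma trace_mult_commute:
  fixes A B :: "'a :: comm_semiring_0 mat"
  assumes "A \<in> carrier_mat m r" "B \<in> carrier_mat r m"
  shows "(\<Sum>i<m. (A * B) $$ (i, i)) = (\<Sum>j<r. (B * A) $$ (j, j))"
proof -
  have "(\<Sum>i<m. (A * B) $$ (i, i)) = (\<Sum>i<m. \<Sum>j<r. A $$ (i, j) * B $$ (j, i))"
    using assms by (intro sum.cong refl) (auto simp: scalar_prod_def lessThan_atLeast0)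
  also have "\<dots> = (\<Sum>j<r. \<Sum>i<m. B $$ (j, i) * A $$ (i, j))"
    by (subst sum.swap) (simp add: mult.commute)
  also have "\<dots> = (\<Sum>j<r. (B * A) $$ (j, j))"
    using assms by (intro sum.cong refl) (auto simp: scalar_prod_def lessThan_atLeast0)
  finally show ?thesis .
qed

lemma trace_eq_mult_single_eigenvalue:
  fixes A :: "complex mat"
  assumes A: "A \<in> carrier_mat m m" and single: "\<And>\<mu>. eigenvalue A \<mu> \<Longrightarrow> \<mu> = s"
  shows "(\<Sum>i<m. A $$ (i, i)) = of_nat m * s"
proof -
  obtain as where "char_poly A = (\<Prod>a\<leftarrow>as. [:- a, 1:])"
    using char_poly_factorized[OF A] by blast
  then obtain T where T: "T \<in> carrier_mat m m" "upper_triangular T" and sim: "similar_mat A T"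
    using schur_decomposition_exists[OF A] by blast
  have diag: "T $$ (i, i) = s" if "i < m" for i
  proof -
    have "poly (char_poly A) (T $$ (i, i)) = 0"
      unfolding char_poly_similar[OF sim] char_poly_upper_triangular[OF T]
      using that T(1) by (auto simp: poly_prod_list diag_mat_def)
    then show ?thesis
      using single eigenvalue_root_char_poly[OF A] by blast
  qed
  obtain P Q where "similar_mat_wit A T P Q"
    using sim by (auto simp: similar_mat_def)
  note PQ = similar_mat_witD2[OF A this]
  have "(\<Sum>i<m. A $$ (i, i)) = (\<Sum>i<m. (P * (T * Q)) $$ (i, i))"
    unfolding PQ(3) using PQ by simp
  also have "\<dots> = (\<Sum>i<m. (T * Q * P) $$ (i, i))"
    using PQ by (intro trace_mult_commute) auto
  also have "T * Q * P = T"
    using PQ by simp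
  finally show ?thesis
    using diag by simp
qed

lemma kernel_eigenvector_other_eigenvalue:
  assumes "(\<Sum>x<m. C x x) \<noteq> of_nat m * s"
  obtains u \<mu> where "kernel_eigenvector m C u \<mu>" "\<mu> \<noteq> s" "\<exists>x<m. u x \<noteq> 0"
proof -
  define A where "A = mat m m (\<lambda>(x, y). C x y)"
  have A: "A \<in> carrier_mat m m"
    by (simp add: A_def)
  have "(\<Sum>x<m. A $$ (x, x)) \<noteq> of_nat m * s"
    using assms by (simp add: A_def)
  then obtain \<mu> u where "\<mu> \<noteq> s" "eigenvector A u \<mu>"
    using trace_eq_mult_single_eigenvalue[OF A] unfolding eigenvalue_def by blast
  then have u: "u \<in> carrier_vec m" "u \<noteq> 0\<^sub>v m" "A *\<^sub>v u = \<mu> \<cdot>\<^sub>v u"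
    using A by (auto simp: eigenvector_def)
  have "kernel_eigenvector m C (($) u) \<mu>"
    unfolding kernel_eigenvector_def kernel_apply_def
  proof (intro allI impI)
    fix x assume "x < m"
    then show "(\<Sum>y<m. C x y * u $ y) = \<mu> * u $ x"
      using arg_cong[OF u(3), of "\<lambda>w. w $ x"] u(1)
      by (simp add: A_def scalar_prod_def lessThan_atLeast0)
  qed
  moreover have "\<exists>x<m. u $ x \<noteq> 0"
    using u(1,2) by (metis carrier_vecD eq_vecI index_zero_vec)
  ultimately show thesis
    using \<open>\<mu> \<noteq> s\<close> that by blast
qed

lemma hermitian_eigenvalue_real:
  assumes "hermitian_kernel m B" "kernel_eigenvector m B u \<mu>" "\<exists>x<m. u x \<noteq> 0"
  shows "\<mu> \<in> \<real>"
proof -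
  have "\<mu> * cinner m u u = cnj \<mu> * cinner m u u"
    using cinner_hermitian_kernel[OF assms(1), of u u]
    by (simp add: cinner_eigenvector_right[OF assms(2)] cinner_eigenvector_left[OF assms(2)])
  moreover have "cinner m u u \<noteq> 0"
    unfolding cinner_self of_real_eq_0_iff using assms(3) by (auto simp: sum_nonneg_eq_0_iff)
  ultimately show ?thesis
    by (simp add: Reals_cnj_iff)
qed

lemma hermitian_eigenvectors_orthogonal:
  assumes "hermitian_kernel m B" "kernel_eigenvector m B u \<mu>" "kernel_eigenvector m B v (of_real s)"
    and "\<mu> \<noteq> of_real s"
  shows "cinner m v u = 0"
proof -
  have "\<mu> * cinner m v u = of_real s * cinner m v u"
    using cinner_hermitian_kernel[OF assms(1), of v u]
    by (simp add: cinner_eigenvector_right[OF assms(2)] cinner_eigenvector_left[OF assms(3)])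
  then show ?thesis
    using assms(4) by simp
qed

definition shift_eigenvalues ::
  "nat \<Rightarrow> (nat \<Rightarrow> nat \<Rightarrow> complex) \<Rightarrow> (nat \<Rightarrow> real) \<Rightarrow> real \<Rightarrow> (nat \<Rightarrow> nat \<Rightarrow> complex) \<Rightarrow> nat \<Rightarrow> nat \<Rightarrow> complex" where
  "shift_eigenvalues r v l s B x y = B x y + (\<Sum>k<r. of_real (s - l k) * v k x * cnj (v k y))"

lemma kernel_apply_shift_eigenvalues:
  "kernel_apply m (shift_eigenvalues r v l s B) u x
    = kernel_apply m B u x + (\<Sum>k<r. of_real (s - l k) * v k x * cinner m (v k) u)"
  unfolding kernel_apply_def shift_eigenvalues_def cinner_def
  by (simp add: ring_distribs sum.distrib sum_distrib_left sum_distrib_right mult.assoc) (rule sum.swap)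

lemma hermitian_shift_eigenvalues: "hermitian_kernel m B \<Longrightarrow> hermitian_kernel m (shift_eigenvalues r v l s B)"
  by (simp add: hermitian_kernel_def shift_eigenvalues_def ac_simps)

lemma shift_eigenvalues_eigenvector:
  assumes "orthonormal m r v" "kernel_eigenvector m B (v k) (of_real (l k))" "k < r"
  shows "kernel_eigenvector m (shift_eigenvalues r v l s B) (v k) (of_real s)"
  using assms(2) unfolding kernel_eigenvector_def kernel_apply_shift_eigenvalues
  by (simp add: orthonormal_eq[OF assms(1) _ assms(3)] assms(3) if_distrib cong: if_cong)
    (simp add: algebra_simps)

lemma trace_shift_eigenvalues:
  assumes "orthonormal m r v"
  shows "(\<Sum>x<m. shift_eigenvalues r v l s B x x) = (\<Sum>x<m. B x x) + of_real (real r * s - (\<Sum>k<r. l k))"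
proof -
  have "(\<Sum>x<m. shift_eigenvalues r v l s B x x)
    = (\<Sum>x<m. B x x) + (\<Sum>k<r. of_real (s - l k) * cinner m (v k) (v k))"
    unfolding shift_eigenvalues_def cinner_def
    by (simp add: sum.distrib sum_distrib_left) (subst sum.swap, simp add: ac_simps)
  then show ?thesis
    by (simp add: orthonormal_eq[OF assms] sum_subtractf)
qed

definition eigensystem ::
  "nat \<Rightarrow> nat \<Rightarrow> (nat \<Rightarrow> nat \<Rightarrow> complex) \<Rightarrow> (nat \<Rightarrow> nat \<Rightarrow> complex) \<Rightarrow> (nat \<Rightarrow> real) \<Rightarrow> bool" where
  "eigensystem m r B v l \<longleftrightarrow>
    orthonormal m r v \<and> (\<forall>k<r. kernel_eigenvector m B (v k) (of_real (l k)))"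

lemma eigensystem_0: "eigensystem m 0 B v l"
  by (simp add: eigensystem_def orthonormal_def)

lemma eigensystem_orthonormal: "eigensystem m r B v l \<Longrightarrow> orthonormal m r v"
  by (simp add: eigensystem_def)

lemma eigensystem_eigenvector:
  "eigensystem m r B v l \<Longrightarrow> k < r \<Longrightarrow> kernel_eigenvector m B (v k) (of_real (l k))"
  by (simp add: eigensystem_def)

text \<open>Move the known eigenvalues to a common value \<open>s\<close>. The trace is affine in \<open>s\<close> with slope \<open>r < m\<close>, so
  some \<open>s\<close> is not the only eigenvalue, and an eigenvector for another one is orthogonal to all known ones.\<close>

lemma hermitian_new_eigenvector:
  assumes herm: "hermitian_kernel m B" and sys: "eigensystem m r B v l" and "r < m"
  obtains u \<mu> where "kernel_eigenvector m B u \<mu>" "\<exists>x<m. u x \<noteq> 0" "\<And>k. k < r \<Longrightarrow> cinner m (v k) u = 0"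
proof -
  let ?C = "shift_eigenvalues r v l"
  note orth = eigensystem_orthonormal[OF sys]
  obtain s where s: "(\<Sum>x<m. ?C s B x x) \<noteq> of_nat m * of_real s"
  proof (rule ccontr)
    assume "\<not> thesis"
    then have "(\<Sum>x<m. B x x) + of_real (real r * s - (\<Sum>k<r. l k)) = of_nat m * of_real s" for s
      using that unfolding trace_shift_eigenvalues[OF orth] by blast
    from arg_cong[OF this, of Re] have "Re (\<Sum>x<m. B x x) + (real r * s - (\<Sum>k<r. l k)) = real m * s" for s
      by simp
    from this[of 0] this[of 1] show False
      using \<open>r < m\<close> by simp
  qed
  obtain u \<mu> where u: "kernel_eigenvector m (?C s B) u \<mu>" "\<exists>x<m. u x \<noteq> 0" and "\<mu> \<noteq> of_real s"
    using kernel_eigenvector_other_eigenvalue[where C="?C s B", OF s] by metis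
  have known: "kernel_eigenvector m (?C s B) (v k) (of_real s)" if "k < r" for k
    using orth eigensystem_eigenvector[OF sys that] that by (rule shift_eigenvalues_eigenvector)
  have ortho: "cinner m (v k) u = 0" if "k < r" for k
    using hermitian_shift_eigenvalues[OF herm] u(1) known[OF that] \<open>\<mu> \<noteq> of_real s\<close>
    by (rule hermitian_eigenvectors_orthogonal)
  then have "kernel_eigenvector m B u \<mu>"
    using u(1) by (simp add: kernel_eigenvector_def kernel_apply_shift_eigenvalues)
  then show thesis
    using u(2) ortho by (rule that)
qed

lemma kernel_apply_scale: "kernel_apply m B (\<lambda>x. s * u x) x = s * kernel_apply m B u x"
  by (simp add: kernel_apply_def sum_distrib_left mult.left_commute)

lemma kernel_eigenvector_scale:
  "kernel_eigenvector m B u \<mu> \<Longrightarrow> kernel_eigenvector m B (\<lambda>x. s * u x) \<mu>"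
  by (simp add: kernel_eigenvector_def kernel_apply_scale)

lemma orthonormal_fun_upd:
  assumes "orthonormal m r v" "cinner m u u = 1" "\<And>k. k < r \<Longrightarrow> cinner m (v k) u = 0"
  shows "orthonormal m (Suc r) (v(r := u))"
proof -
  have "cinner m u (v k) = 0" if "k < r" for k
    using cinner_cnj[of m "v k" u] assms(3)[OF that] by simp
  then show ?thesis
    using assms by (auto simp: orthonormal_def less_Suc_eq)
qed

lemma eigensystem_fun_upd:
  assumes "eigensystem m r B v l" "kernel_eigenvector m B u (of_real \<mu>)" "cinner m u u = 1"
    and "\<And>k. k < r \<Longrightarrow> cinner m (v k) u = 0"
  shows "eigensystem m (Suc r) B (v(r := u)) (l(r := \<mu>))"
  using assms orthonormal_fun_upd[of m r v u] by (auto simp: eigensystem_def less_Suc_eq)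

lemma hermitian_eigensystem_exists:
  assumes herm: "hermitian_kernel m B" and "r \<le> m"
  shows "\<exists>v l. eigensystem m r B v l"
  using \<open>r \<le> m\<close>
proof (induction r)
  case (Suc r)
  then obtain v l where sys: "eigensystem m r B v l"
    by auto
  obtain u \<mu> where u: "kernel_eigenvector m B u \<mu>" "\<exists>x<m. u x \<noteq> 0" "\<And>k. k < r \<Longrightarrow> cinner m (v k) u = 0"
    using hermitian_new_eigenvector[OF herm sys] Suc.prems by auto
  define N where "N = (\<Sum>x<m. (cmod (u x))\<^sup>2)"
  define w where "w = (\<lambda>x. of_real (1 / sqrt N) * u x)"
  have "N > 0"
    unfolding N_def using u(2) by (auto intro: sum_pos2)
  have "cinner m w w = of_real (1 / sqrt N * (1 / sqrt N) * N)"
    unfolding w_def cinner_scale_left cinner_scale_right cinner_self N_def[symmetric]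
    by (simp only: complex_cnj_complex_of_real of_real_mult mult.assoc)
  also have "1 / sqrt N * (1 / sqrt N) * N = 1"
    using \<open>N > 0\<close> by simp
  finally have "cinner m w w = 1"
    by simp
  moreover have "cinner m (v k) w = 0" if "k < r" for k
    unfolding w_def cinner_scale_right u(3)[OF that] by simp
  moreover have "kernel_eigenvector m B w (of_real (Re \<mu>))"
    unfolding w_def of_real_Re[OF hermitian_eigenvalue_real[OF herm u(1,2)]]
    by (rule kernel_eigenvector_scale[OF u(1)])
  ultimately show ?case
    using eigensystem_fun_upd[OF sys] by blast
qed (use eigensystem_0 in blast)

lemma eigensystem_kernel_eq:
  assumes sys: "eigensystem m m B v l" and "x < m" "y < m"
  shows "B x y = (\<Sum>k<m. of_real (l k) * v k x * cnj (v k y))"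
proof -
  have "(\<Sum>k<m. of_real (l k) * v k x * cnj (v k y)) = (\<Sum>k<m. kernel_apply m B (v k) x * cnj (v k y))"
    using eigensystem_eigenvector[OF sys] \<open>x < m\<close> by (simp add: kernel_eigenvector_def)
  also have "\<dots> = (\<Sum>z<m. B x z * (\<Sum>k<m. v k z * cnj (v k y)))"
    unfolding kernel_apply_def sum_distrib_left sum_distrib_right mult.assoc by (rule sum.swap)
  also have "\<dots> = B x y"
    using \<open>y < m\<close>
    by (simp add: orthonormal_complete[OF eigensystem_orthonormal[OF sys]] if_distrib cong: if_cong)
  finally show ?thesis ..
qed

section \<open>Gram kernels\<close>

definition gram_kernel :: "'r set \<Rightarrow> ('r \<Rightarrow> 'a \<Rightarrow> complex) \<Rightarrow> 'a \<Rightarrow> 'a \<Rightarrow> complex" where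
  "gram_kernel R g x y = (\<Sum>r\<in>R. g r x * cnj (g r y))"

lemma gram_kernel_diag: "gram_kernel R g x x = of_real (\<Sum>r\<in>R. (cmod (g r x))\<^sup>2)"
  by (simp add: gram_kernel_def complex_norm_square del: of_real_power)

lemma hermitian_gram_kernel: "hermitian_kernel m (gram_kernel R g)"
  by (simp add: hermitian_kernel_def gram_kernel_def mult.commute)

lemma cinner_gram_kernel:
  "cinner m u (kernel_apply m (gram_kernel R g) u) = of_real (\<Sum>r\<in>R. (cmod (cinner m u (g r)))\<^sup>2)"
proof -
  have "cinner m u (kernel_apply m (gram_kernel R g) u)
    = (\<Sum>x<m. \<Sum>y<m. \<Sum>r\<in>R. (cnj (u x) * g r x) * (cnj (g r y) * u y))"
    by (simp add: cinner_def kernel_apply_def gram_kernel_def sum_distrib_left sum_distrib_right ac_simps)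
  also have "\<dots> = (\<Sum>r\<in>R. \<Sum>x<m. \<Sum>y<m. (cnj (u x) * g r x) * (cnj (g r y) * u y))"
    by (rule trans[OF sum.cong[OF refl sum.swap] sum.swap])
  also have "\<dots> = (\<Sum>r\<in>R. cinner m u (g r) * cnj (cinner m u (g r)))"
    by (simp only: cinner_cnj) (simp only: cinner_def sum_product)
  finally show ?thesis
    by (simp add: complex_norm_square del: of_real_power)
qed

lemma gram_kernel_eigenvalue:
  assumes "kernel_eigenvector m (gram_kernel R g) u (of_real l)"
  shows "l * (\<Sum>x<m. (cmod (u x))\<^sup>2) = (\<Sum>r\<in>R. (cmod (cinner m u (g r)))\<^sup>2)"
proof -
  have "complex_of_real (l * (\<Sum>x<m. (cmod (u x))\<^sup>2)) = of_real (\<Sum>r\<in>R. (cmod (cinner m u (g r)))\<^sup>2)"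
    using cinner_gram_kernel[of m u R g]
    unfolding cinner_eigenvector_right[OF assms] cinner_self of_real_mult[symmetric] .
  then show ?thesis
    unfolding of_real_eq_iff .
qed

lemma gram_kernel_eigensystem:
  obtains v l where "eigensystem m m (gram_kernel R g) v l"
  using hermitian_eigensystem_exists[OF hermitian_gram_kernel order_refl] by blast

lemma gram_kernel_eigenvalue_nonneg:
  assumes "eigensystem m r (gram_kernel R g) v l" "k < r"
  shows "l k \<ge> 0"
  using gram_kernel_eigenvalue[OF eigensystem_eigenvector[OF assms]]
    orthonormal_sum_cmod[OF eigensystem_orthonormal[OF assms(1)] assms(2)]
  by (simp add: sum_nonneg)

lemma gram_kernel_eq_eigenvector_gram_kernel:
  assumes "eigensystem m m (gram_kernel R g) v l" "x < m" "y < m"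
  shows "gram_kernel R g x y = gram_kernel {..<m} (\<lambda>k x. of_real (sqrt (l k)) * v k x) x y"
proof -
  have "gram_kernel R g x y = (\<Sum>k<m. of_real (sqrt (l k) * sqrt (l k)) * v k x * cnj (v k y))"
    using eigensystem_kernel_eq[OF assms] gram_kernel_eigenvalue_nonneg[OF assms(1)] by simp
  then show ?thesis
    unfolding of_real_mult by (simp add: gram_kernel_def[of "{..<m}"] ac_simps)
qed

lemma gram_kernel_diag_eq_eigenvalue_sum:
  assumes "eigensystem m m (gram_kernel R g) v l" "x < m"
  shows "(\<Sum>r\<in>R. (cmod (g r x))\<^sup>2) = (\<Sum>k<m. (cmod (v k x))\<^sup>2 * l k)"
proof -
  have "(\<Sum>r\<in>R. (cmod (g r x))\<^sup>2) = (\<Sum>k<m. (cmod (of_real (sqrt (l k)) * v k x))\<^sup>2)"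
    using gram_kernel_eq_eigenvector_gram_kernel[OF assms assms(2)]
    unfolding gram_kernel_diag of_real_eq_iff .
  then show ?thesis
    by (simp add: norm_mult power_mult_distrib gram_kernel_eigenvalue_nonneg[OF assms(1)] mult.commute)
qed

lemma complex_Cauchy_Schwarz_sum:
  fixes u v :: "'a \<Rightarrow> complex"
  shows "(cmod (\<Sum>x\<in>A. cnj (u x) * v x))\<^sup>2 \<le> (\<Sum>x\<in>A. (cmod (u x))\<^sup>2) * (\<Sum>x\<in>A. (cmod (v x))\<^sup>2)"
proof -
  have "cmod (\<Sum>x\<in>A. cnj (u x) * v x) \<le> (\<Sum>x\<in>A. \<bar>cmod (u x)\<bar> * \<bar>cmod (v x)\<bar>)"
    by (rule order_trans[OF norm_sum]) (simp add: norm_mult)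
  also have "\<dots> \<le> L2_set (\<lambda>x. cmod (u x)) A * L2_set (\<lambda>x. cmod (v x)) A"
    by (rule L2_set_mult_ineq)
  finally have "(cmod (\<Sum>x\<in>A. cnj (u x) * v x))\<^sup>2 \<le> (L2_set (\<lambda>x. cmod (u x)) A * L2_set (\<lambda>x. cmod (v x)) A)\<^sup>2"
    by (rule power_mono) simp
  then show ?thesis
    by (simp add: power_mult_distrib L2_set_def sum_nonneg)
qed

text \<open>The part of an eigenvector in one block is again an eigenvector;
  Cauchy-Schwarz bounds its Rayleigh quotient.\<close>

lemma gram_kernel_eigenvalue_le_block_trace:
  assumes block: "\<And>x y. x < m \<Longrightarrow> y < m \<Longrightarrow> f x \<noteq> f y \<Longrightarrow> gram_kernel R g x y = 0"
    and eig: "kernel_eigenvector m (gram_kernel R g) v (of_real l)"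
    and nz: "x < m" "v x \<noteq> 0"
  shows "l \<le> (\<Sum>z | z < m \<and> f z = f x. \<Sum>r\<in>R. (cmod (g r z))\<^sup>2)"
proof -
  define Z where "Z = {z. z < m \<and> f z = f x}"
  define u where "u = (\<lambda>z. if f z = f x then v z else 0)"
  define N where "N = (\<Sum>z\<in>Z. (cmod (v z))\<^sup>2)"
  have norm_u: "(\<Sum>z<m. (cmod (u z))\<^sup>2) = N"
    unfolding N_def by (rule sum.mono_neutral_cong_right) (auto simp: u_def Z_def)
  have cinner_u: "cinner m u w = (\<Sum>z\<in>Z. cnj (v z) * w z)" for w
    unfolding cinner_def by (rule sum.mono_neutral_cong_right) (auto simp: u_def Z_def)
  have "kernel_apply m (gram_kernel R g) u z = of_real l * u z" if "z < m" for z
  proof -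
    have "kernel_apply m (gram_kernel R g) u z
      = (if f z = f x then kernel_apply m (gram_kernel R g) v z else 0)"
      unfolding kernel_apply_def u_def using that block by (auto intro!: sum.cong sum.neutral)
    then show ?thesis
      using eig that by (simp add: kernel_eigenvector_def u_def)
  qed
  then have "kernel_eigenvector m (gram_kernel R g) u (of_real l)"
    by (simp add: kernel_eigenvector_def)
  then have "l * N = (\<Sum>r\<in>R. (cmod (\<Sum>z\<in>Z. cnj (v z) * g r z))\<^sup>2)"
    unfolding norm_u[symmetric] cinner_u[symmetric] by (rule gram_kernel_eigenvalue)
  also have "\<dots> \<le> (\<Sum>r\<in>R. N * (\<Sum>z\<in>Z. (cmod (g r z))\<^sup>2))"
    unfolding N_def by (intro sum_mono complex_Cauchy_Schwarz_sum)
  also have "\<dots> = (\<Sum>z\<in>Z. \<Sum>r\<in>R. (cmod (g r z))\<^sup>2) * N"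
    by (subst sum.swap) (simp add: sum_distrib_left mult.commute)
  finally have "l * N \<le> (\<Sum>z\<in>Z. \<Sum>r\<in>R. (cmod (g r z))\<^sup>2) * N" .
  moreover have "N > 0"
    unfolding N_def using nz by (intro sum_pos2[of _ x]) (auto simp: Z_def)
  ultimately show ?thesis
    by (simp add: Z_def)
qed

section \<open>Shannon entropy\<close>

definition shannon_entropy :: "real \<Rightarrow> 'a set \<Rightarrow> ('a \<Rightarrow> real) \<Rightarrow> real" where
  "shannon_entropy b A p = - (\<Sum>x\<in>A. p x * log b (p x))"

lemma shannon_entropy_cong: "(\<And>x. x \<in> A \<Longrightarrow> p x = q x) \<Longrightarrow> shannon_entropy b A p = shannon_entropy b A q"
  by (simp add: shannon_entropy_def)

lemma shannon_entropy_reindex_bij_betw: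
  "bij_betw h A B \<Longrightarrow> shannon_entropy b A (\<lambda>x. p (h x)) = shannon_entropy b B p"
  unfolding shannon_entropy_def by (simp add: sum.reindex_bij_betw[of h A B "\<lambda>x. p x * log b (p x)"])

lemma xlogx_mult:
  fixes x y :: real
  assumes "x \<ge> 0" "y \<ge> 0"
  shows "x * y * log b (x * y) = x * log b x * y + x * (y * log b y)"
  using assms by (cases "x = 0 \<or> y = 0") (auto simp: log_mult algebra_simps)

lemma shannon_entropy_chain_rule:
  assumes p: "\<And>x. x \<in> A \<Longrightarrow> p x \<ge> 0" and W: "\<And>x y. x \<in> A \<Longrightarrow> y \<in> B \<Longrightarrow> W x y \<ge> 0"
    and stochastic: "\<And>x. x \<in> A \<Longrightarrow> (\<Sum>y\<in>B. W x y) = 1"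
  shows "shannon_entropy b (A \<times> B) (\<lambda>(x, y). p x * W x y)
    = shannon_entropy b A p + (\<Sum>x\<in>A. p x * shannon_entropy b B (W x))"
proof -
  have "(\<Sum>(x, y)\<in>A \<times> B. p x * W x y * log b (p x * W x y))
    = (\<Sum>x\<in>A. \<Sum>y\<in>B. p x * log b (p x) * W x y + p x * (W x y * log b (W x y)))"
    unfolding sum.cartesian_product[symmetric] using p W by (intro sum.cong refl xlogx_mult) auto
  also have "\<dots> = (\<Sum>x\<in>A. p x * log b (p x) + p x * (\<Sum>y\<in>B. W x y * log b (W x y)))"
    by (simp add: sum.distrib stochastic flip: sum_distrib_left)
  finally show ?thesis
    by (simp add: shannon_entropy_def sum.distrib sum_negf case_prod_beta)
qed

lemma xlogx_tangent:
  fixes t q :: real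
  assumes "b > 1" "t \<ge> 0" "q > 0"
  shows "t * log b q + (t - q) / ln b \<le> t * log b t"
proof (cases "t = 0")
  case True
  then show ?thesis
    using assms by (simp add: divide_nonneg_pos)
next
  case False
  then have "t > 0"
    using assms by simp
  then have "t * (ln q - ln t) \<le> t * (q / t - 1)"
    using ln_le_minus_one[of "q / t"] assms by (intro mult_left_mono) (auto simp: ln_div)
  also have "\<dots> = q - t"
    using \<open>t > 0\<close> by (simp add: field_simps)
  finally show ?thesis
    using assms divide_right_mono[of _ "q - t" "ln b"]
    by (fastforce simp: log_def right_diff_distrib diff_divide_distrib)
qed

lemma xlogx_jensen:
  fixes D l :: "'a \<Rightarrow> real"
  assumes "b > 1" "finite K" and D: "\<And>k. k \<in> K \<Longrightarrow> D k \<ge> 0" "(\<Sum>k\<in>K. D k) = 1"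
    and l: "\<And>k. k \<in> K \<Longrightarrow> l k \<ge> 0"
  defines "q \<equiv> \<Sum>k\<in>K. D k * l k"
  shows "q * log b q \<le> (\<Sum>k\<in>K. D k * (l k * log b (l k)))"
proof (cases "q = 0")
  case True
  then have "D k * l k = 0" if "k \<in> K" for k
    using that D l \<open>finite K\<close> by (auto simp: q_def sum_nonneg_eq_0_iff)
  then have "(\<Sum>k\<in>K. D k * (l k * log b (l k))) = 0"
    by (intro sum.neutral) auto
  then show ?thesis
    using True by simp
next
  case False
  moreover have "q \<ge> 0"
    using D l by (auto simp: q_def intro: sum_nonneg)
  ultimately have "q > 0"
    by simp
  have "q * log b q = (\<Sum>k\<in>K. D k * l k) * log b q + ((\<Sum>k\<in>K. D k * l k) - (\<Sum>k\<in>K. D k) * q) / ln b"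
    by (simp add: D(2) flip: q_def)
  also have "\<dots> = (\<Sum>k\<in>K. D k * (l k * log b q + (l k - q) / ln b))"
    by (simp add: sum_distrib_left sum_distrib_right sum_divide_distrib algebra_simps sum.distrib
        sum_subtractf diff_divide_distrib)
  also have "\<dots> \<le> (\<Sum>k\<in>K. D k * (l k * log b (l k)))"
    using assms \<open>q > 0\<close> by (intro sum_mono mult_left_mono xlogx_tangent) auto
  finally show ?thesis .
qed

lemma shannon_entropy_doubly_stochastic:
  fixes D :: "'a \<Rightarrow> 'b \<Rightarrow> real"
  assumes "b > 1" "finite K" and D: "\<And>k x. D k x \<ge> 0"
    and rows: "\<And>k. k \<in> K \<Longrightarrow> (\<Sum>x\<in>X. D k x) = 1"
    and cols: "\<And>x. x \<in> X \<Longrightarrow> (\<Sum>k\<in>K. D k x) = 1"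
    and l: "\<And>k. k \<in> K \<Longrightarrow> l k \<ge> 0"
  shows "shannon_entropy b K l \<le> shannon_entropy b X (\<lambda>x. \<Sum>k\<in>K. D k x * l k)"
proof -
  let ?q = "\<lambda>x. \<Sum>k\<in>K. D k x * l k"
  have "(\<Sum>x\<in>X. ?q x * log b (?q x)) \<le> (\<Sum>x\<in>X. \<Sum>k\<in>K. D k x * (l k * log b (l k)))"
    using assms by (intro sum_mono xlogx_jensen) auto
  also have "\<dots> = (\<Sum>k\<in>K. (\<Sum>x\<in>X. D k x) * (l k * log b (l k)))"
    unfolding sum_distrib_right by (rule sum.swap)
  also have "\<dots> = (\<Sum>k\<in>K. l k * log b (l k))"
    by (simp add: rows)
  finally show ?thesis
    by (simp add: shannon_entropy_def)
qed

section \<open>Von Neumann entropy\<close>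

lemma char_poly_block_lower_triangular:
  fixes A :: "complex mat"
  assumes "A \<in> carrier_mat m m" "C \<in> carrier_mat r m" "D \<in> carrier_mat r r"
  shows "char_poly (four_block_mat A (0\<^sub>m m r) C D) = char_poly A * char_poly D"
  using assms char_poly_factorized by (intro char_poly_0_block'[OF refl]) blast+

lemma char_poly_zero_mat: "char_poly (0\<^sub>m m m) = ([:0, 1:] :: 'a :: comm_ring_1 poly) ^ m"
  by (subst char_poly_upper_triangular[where n=m]) (auto simp: diag_mat_def prod.list_conv_set_nth)

lemma char_poly_mult_commute:
  fixes A B :: "complex mat"
  assumes A: "A \<in> carrier_mat m r" and B: "B \<in> carrier_mat r m"
  shows "char_poly (A * B) * [:0, 1:] ^ r = [:0, 1:] ^ m * char_poly (B * A)"
proof -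
  define M where "M = four_block_mat (A * B) (0\<^sub>m m r) B (0\<^sub>m r r)"
  define N where "N = four_block_mat (0\<^sub>m m m) (0\<^sub>m m r) B (B * A)"
  define P where "P = four_block_mat (1\<^sub>m m) A (0\<^sub>m r m) (1\<^sub>m r)"
  define Q where "Q = four_block_mat (1\<^sub>m m) (- A) (0\<^sub>m r m) (1\<^sub>m r)"
  note block_mult = mult_four_block_mat[where ?nr1.0=m and ?n1.0=m and ?nc1.0=m
      and ?n2.0=r and ?nr2.0=r and ?nc2.0=r]
  have "P * Q = 1\<^sub>m (m + r)" "Q * P = 1\<^sub>m (m + r)"
    unfolding P_def Q_def using A
    by (subst block_mult; auto simp: comm_add_mat[of A m r "- A"] intro!: eq_matI; fail)+
  moreover have "M = P * N * Q"
    unfolding M_def N_def P_def Q_def using A B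
    by (subst block_mult; (subst block_mult)?;
        simp add: uminus_l_inv_mat[where nr=m and nc=r] uminus_l_inv_mat[where nr=r and nc=r])
  ultimately have "similar_mat_wit M N P Q"
    using A B unfolding M_def N_def P_def Q_def by (intro similar_mat_witI[where n="m + r"]) auto
  then have "char_poly M = char_poly N"
    using char_poly_similar unfolding similar_mat_def by blast
  then show ?thesis
    unfolding M_def N_def using A B
    by (simp add: char_poly_block_lower_triangular[where m=m and r=r] char_poly_zero_mat)
qed

lemma sum_mset_conv_sum_count:
  fixes f :: "'a \<Rightarrow> 'b :: comm_semiring_1"
  shows "(\<Sum>x\<in>#M. f x) = (\<Sum>x\<in>set_mset M. of_nat (count M x) * f x)"
proof (induction M)
  case (add y M)
  have "(\<Sum>x\<in>set_mset (add_mset y M). of_nat (count (add_mset y M) x) * f x)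
    = (\<Sum>x\<in>insert y (set_mset M). of_nat (count M x) * f x + (if x = y then f y else 0))"
    by (intro sum.cong) (auto simp: algebra_simps)
  also have "\<dots> = (\<Sum>x\<in>insert y (set_mset M). of_nat (count M x) * f x) + f y"
    by (simp add: sum.distrib)
  also have "(\<Sum>x\<in>insert y (set_mset M). of_nat (count M x) * f x)
    = (\<Sum>x\<in>set_mset M. of_nat (count M x) * f x)"
    by (intro sum.mono_neutral_right) (auto simp: not_in_iff)
  finally show ?case
    using add.IH by (simp add: add.commute)
qed simp

lemma vn_entropy_eq_sum_proots:
  assumes "char_poly A \<noteq> 0"
  shows "vn_entropy d A = - (\<Sum>z\<in>#proots (char_poly A). Re z * log d (Re z))"
  using assms by (simp add: vn_entropy_def sum_mset_conv_sum_count)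

lemma vn_entropy_eq_shannon_entropy:
  fixes p :: "'a \<Rightarrow> real"
  assumes cp: "char_poly A * [:0, 1:] ^ r = [:0, 1:] ^ m * (\<Prod>y\<in>J. [:- of_real (p y), 1:])"
    and A: "A \<in> carrier_mat m m"
  shows "vn_entropy d A = shannon_entropy d J p"
proof -
  let ?f = "\<lambda>z. Re z * log d (Re z)"
  have cp_nz: "char_poly A \<noteq> 0"
    using degree_monic_char_poly[OF A] by auto
  have nz: "(\<Prod>y\<in>J. [:- complex_of_real (p y), 1:]) \<noteq> 0"
    by (cases "finite J") auto
  have "proots (char_poly A) + repeat_mset r {#0#} = repeat_mset m {#0#} + (\<Sum>y\<in>J. {#of_real (p y)#})"
    using arg_cong[OF cp, of proots] cp_nz nz by (simp add: proots_mult proots_power proots_prod)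
  from arg_cong[OF this, of "\<lambda>R. \<Sum>z\<in>#R. ?f z"]
  have "(\<Sum>z\<in>#proots (char_poly A). ?f z) = (\<Sum>z\<in>#(\<Sum>y\<in>J. {#of_real (p y)#}). ?f z)"
    by simp
  also have "\<dots> = (\<Sum>y\<in>J. p y * log d (p y))"
    by (induction J rule: infinite_finite_induct) auto
  finally show ?thesis
    by (simp add: vn_entropy_eq_sum_proots cp_nz shannon_entropy_def)
qed

lemma vn_entropy_orthogonal_gram:
  assumes "finite J"
    and orth: "\<And>x y. x \<in> J \<Longrightarrow> y \<in> J \<Longrightarrow> cinner m (w x) (w y) = (if x = y then of_real (p x) else 0)"
  shows "vn_entropy d (mat m m (\<lambda>(i, j). gram_kernel J w i j)) = shannon_entropy d J p"
proof -
  define r where "r = card J"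
  obtain h where h: "bij_betw h {..<r} J"
    using ex_bij_betw_nat_finite[OF \<open>finite J\<close>] by (auto simp: r_def lessThan_atLeast0)
  then have h_in: "h k \<in> J" and h_inj: "h k = h l \<longleftrightarrow> k = l" if "k < r" "l < r" for k l
    using that by (auto simp: bij_betw_def inj_on_def)
  define A where "A = mat m r (\<lambda>(i, k). w (h k) i)"
  define B where "B = mat r m (\<lambda>(k, i). cnj (w (h k) i))"
  have A: "A \<in> carrier_mat m r" and B: "B \<in> carrier_mat r m"
    by (auto simp: A_def B_def)
  have AB: "mat m m (\<lambda>(i, j). gram_kernel J w i j) = A * B"
    unfolding gram_kernel_def sum.reindex_bij_betw[OF h, symmetric]
    by (intro eq_matI) (auto simp: A_def B_def scalar_prod_def lessThan_atLeast0)
  have BA: "B * A = mat r r (\<lambda>(k, l). if k = l then of_real (p (h k)) else 0)"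
    using orth h_in h_inj
    by (intro eq_matI) (auto simp: A_def B_def scalar_prod_def cinner_def simp flip: lessThan_atLeast0)
  have "char_poly (B * A) = (\<Prod>k<r. [:- of_real (p (h k)), 1:])"
    unfolding BA by (subst char_poly_upper_triangular[where n=r])
      (auto simp: diag_mat_def prod.list_conv_set_nth lessThan_atLeast0)
  also have "\<dots> = (\<Prod>y\<in>J. [:- of_real (p y), 1:])"
    by (rule prod.reindex_bij_betw[OF h])
  finally show ?thesis
    using vn_entropy_eq_shannon_entropy[of "A * B" r m p J d] char_poly_mult_commute[OF A B] A B
    by (simp add: AB)
qed

lemma vn_entropy_gram_eq_eigenvalue_entropy:
  assumes "eigensystem m m (gram_kernel R g) v l"
  shows "vn_entropy d (mat m m (\<lambda>(i, j). gram_kernel R g i j)) = shannon_entropy d {..<m} l"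
proof -
  define w where "w = (\<lambda>k x. of_real (sqrt (l k)) * v k x)"
  have "mat m m (\<lambda>(i, j). gram_kernel R g i j) = mat m m (\<lambda>(i, j). gram_kernel {..<m} w i j)"
    using gram_kernel_eq_eigenvector_gram_kernel[OF assms] unfolding w_def by (intro eq_matI) auto
  moreover have "vn_entropy d (mat m m (\<lambda>(i, j). gram_kernel {..<m} w i j)) = shannon_entropy d {..<m} l"
  proof (rule vn_entropy_orthogonal_gram)
    show "cinner m (w j) (w k) = (if j = k then of_real (l j) else 0)" if "j \<in> {..<m}" "k \<in> {..<m}" for j k
      using that gram_kernel_eigenvalue_nonneg[OF assms]
      by (simp add: w_def cinner_scale_left cinner_scale_right
          orthonormal_eq[OF eigensystem_orthonormal[OF assms]] flip: of_real_mult)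
  qed simp
  ultimately show ?thesis
    by simp
qed

lemma vn_entropy_le_diagonal_entropy:
  fixes d :: nat
  assumes "d > 1"
  shows "vn_entropy d (mat m m (\<lambda>(i, j). gram_kernel R g i j))
    \<le> shannon_entropy d {..<m} (\<lambda>x. \<Sum>r\<in>R. (cmod (g r x))\<^sup>2)"
proof -
  obtain v l where sys: "eigensystem m m (gram_kernel R g) v l"
    by (rule gram_kernel_eigensystem)
  note orth = eigensystem_orthonormal[OF sys]
  have "shannon_entropy d {..<m} l \<le> shannon_entropy d {..<m} (\<lambda>x. \<Sum>k<m. (cmod (v k x))\<^sup>2 * l k)"
    using assms gram_kernel_eigenvalue_nonneg[OF sys] orthonormal_sum_cmod[OF orth]
      orthonormal_complete_sum_cmod[OF orth]
    by (intro shannon_entropy_doubly_stochastic) auto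
  then show ?thesis
    unfolding vn_entropy_gram_eq_eigenvalue_entropy[OF sys]
    by (simp add: shannon_entropy_def gram_kernel_diag_eq_eigenvalue_sum[OF sys])
qed

lemma vn_entropy_ge_block_entropy:
  fixes d :: nat
  assumes "d > 1" "finite J" and f: "\<And>x. x < m \<Longrightarrow> f x \<in> J"
    and block: "\<And>x y. x < m \<Longrightarrow> y < m \<Longrightarrow> f x \<noteq> f y \<Longrightarrow> gram_kernel R g x y = 0"
  shows "shannon_entropy d J (\<lambda>y. \<Sum>x | x < m \<and> f x = y. \<Sum>r\<in>R. (cmod (g r x))\<^sup>2)
    \<le> vn_entropy d (mat m m (\<lambda>(i, j). gram_kernel R g i j))"
proof -
  obtain v l where sys: "eigensystem m m (gram_kernel R g) v l"
    by (rule gram_kernel_eigensystem)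
  define p where "p = (\<lambda>y. \<Sum>x | x < m \<and> f x = y. \<Sum>r\<in>R. (cmod (g r x))\<^sup>2)"
  have term_le: "(cmod (v k x))\<^sup>2 * (l k * log d (l k)) \<le> (cmod (v k x))\<^sup>2 * (l k * log d (p (f x)))"
    if "k < m" "x < m" for k x
  proof (cases "v k x = 0 \<or> l k = 0")
    case False
    then have "0 < l k" "l k \<le> p (f x)"
      using gram_kernel_eigenvalue_nonneg[OF sys that(1)]
        gram_kernel_eigenvalue_le_block_trace[OF block eigensystem_eigenvector[OF sys that(1)] that(2)]
      by (auto simp: p_def)
    then show ?thesis
      using \<open>d > 1\<close> by (intro mult_left_mono) auto
  qed auto
  have "(\<Sum>k<m. l k * log d (l k)) = (\<Sum>k<m. \<Sum>x<m. (cmod (v k x))\<^sup>2 * (l k * log d (l k)))"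
    by (simp add: orthonormal_sum_cmod[OF eigensystem_orthonormal[OF sys]] flip: sum_distrib_right)
  also have "\<dots> \<le> (\<Sum>k<m. \<Sum>x<m. (cmod (v k x))\<^sup>2 * (l k * log d (p (f x))))"
    using term_le by (intro sum_mono) auto
  also have "\<dots> = (\<Sum>x<m. (\<Sum>r\<in>R. (cmod (g r x))\<^sup>2) * log d (p (f x)))"
    by (subst sum.swap) (simp add: gram_kernel_diag_eq_eigenvalue_sum[OF sys] sum_distrib_right mult.assoc)
  also have "\<dots> = (\<Sum>y\<in>J. \<Sum>x | x \<in> {..<m} \<and> f x = y. (\<Sum>r\<in>R. (cmod (g r x))\<^sup>2) * log d (p (f x)))"
    using f \<open>finite J\<close> by (intro sum.group[symmetric]) auto
  also have "\<dots> = (\<Sum>y\<in>J. p y * log d (p y))"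
    by (simp add: p_def sum_distrib_right)
  finally show ?thesis
    unfolding vn_entropy_gram_eq_eigenvalue_entropy[OF sys] p_def by (simp add: shannon_entropy_def)
qed

section \<open>Register configurations\<close>

definition configs :: "nat \<Rightarrow> nat set \<Rightarrow> (nat \<Rightarrow> nat) set" where
  "configs d X = {c. \<forall>p. (p \<in> X \<longrightarrow> c p \<in> {..<d}) \<and> (p \<notin> X \<longrightarrow> c p = 0)}"

definition config_restrict :: "nat set \<Rightarrow> (nat \<Rightarrow> nat) \<Rightarrow> nat \<Rightarrow> nat" where
  "config_restrict X c p = (if p \<in> X then c p else 0)"

lemma finite_configs [simp]: "finite X \<Longrightarrow> finite (configs d X)"
  unfolding configs_def by (rule finite_set_of_finite_funs) auto

lemma configs_less: "c \<in> configs d X \<Longrightarrow> p \<in> X \<Longrightarrow> c p < d"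
  by (simp add: configs_def)

lemma configs_eq_0: "c \<in> configs d X \<Longrightarrow> p \<notin> X \<Longrightarrow> c p = 0"
  by (simp add: configs_def)

lemma configs_empty [simp]: "configs d {} = {0}"
  by (auto simp: configs_def)

lemma config_restrict_in_configs: "c \<in> configs d Y \<Longrightarrow> X \<subseteq> Y \<Longrightarrow> config_restrict X c \<in> configs d X"
  by (auto simp: configs_def config_restrict_def)

lemma config_restrict_ident: "c \<in> configs d X \<Longrightarrow> config_restrict X c = c"
  by (auto simp: configs_def config_restrict_def)

lemma config_restrict_eq_iff: "config_restrict X a = config_restrict X c \<longleftrightarrow> (\<forall>p\<in>X. a p = c p)"
  by (auto simp: config_restrict_def fun_eq_iff)

lemma config_restrict_restrict: "Y \<subseteq> X \<Longrightarrow> config_restrict Y (config_restrict X c) = config_restrict Y c"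
  by (auto simp: config_restrict_def fun_eq_iff)

lemma configs_mono: "X \<subseteq> Y \<Longrightarrow> d > 0 \<Longrightarrow> configs d X \<subseteq> configs d Y"
  by (auto simp: configs_def) (metis)

lemma configs_Diff_nonzero:
  assumes "c \<in> configs d Y - configs d X" "X \<subseteq> Y"
  obtains p where "p \<in> Y - X" "c p \<noteq> 0"
proof -
  obtain p where "p \<notin> X" "c p \<noteq> 0"
    using assms by (auto simp: configs_def)
  moreover from this have "p \<in> Y"
    using assms(1) configs_eq_0[of c d Y p] by auto
  ultimately show thesis
    using that by blast
qed

lemma bij_betw_configs_insert:
  assumes "p \<notin> X"
  shows "bij_betw (\<lambda>(c, x). c(p := x)) (configs d X \<times> {..<d}) (configs d (insert p X))"
  using assms
  by (intro bij_betw_byWitness[where f'="\<lambda>c. (c(p := 0), c p)"]) (auto simp: configs_def fun_eq_iff)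

lemma sum_configs_insert:
  assumes "p \<notin> X"
  shows "sum f (configs d (insert p X)) = (\<Sum>c\<in>configs d X. \<Sum>x<d. f (c(p := x)))"
  unfolding sum.cartesian_product sum.reindex_bij_betw[OF bij_betw_configs_insert[OF assms], symmetric]
  by (simp add: case_prod_beta)

lemma config_restrict_add_compl:
  assumes "c \<in> configs d S"
  shows "config_restrict X c + config_restrict (S - X) c = c"
  using configs_eq_0[OF assms] by (auto simp: fun_eq_iff config_restrict_def)

lemma configs_add:
  assumes a: "a \<in> configs d X" and r: "r \<in> configs d (S - X)" and "X \<subseteq> S"
  shows "a + r \<in> configs d S" "config_restrict X (a + r) = a" "config_restrict (S - X) (a + r) = r"
proof -
  have "(a + r) p = (if p \<in> X then a p else r p)" for p
    using configs_eq_0[OF a, of p] configs_eq_0[OF r, of p] by auto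
  then show "a + r \<in> configs d S" "config_restrict X (a + r) = a" "config_restrict (S - X) (a + r) = r"
    using \<open>X \<subseteq> S\<close> configs_less[OF a] configs_less[OF r] configs_eq_0[OF a] configs_eq_0[OF r]
    by (auto simp: configs_def config_restrict_def fun_eq_iff simp del: plus_fun_apply)
qed

lemma sum_configs_fiber:
  assumes X: "X \<subseteq> S" and a: "a \<in> configs d X"
  shows "(\<Sum>r\<in>configs d (S - X). f (a + r)) = (\<Sum>c | c \<in> configs d S \<and> config_restrict X c = a. f c)"
proof (rule sum.reindex_bij_witness[where i="config_restrict (S - X)" and j="\<lambda>r. a + r"])
  fix r assume "r \<in> configs d (S - X)"
  then show "config_restrict (S - X) (a + r) = r" "a + r \<in> {c \<in> configs d S. config_restrict X c = a}"
    using configs_add[OF a _ X] by auto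
next
  fix c assume "c \<in> {c \<in> configs d S. config_restrict X c = a}"
  then show "a + config_restrict (S - X) c = c" "config_restrict (S - X) c \<in> configs d (S - X)"
    using config_restrict_add_compl[of c d S X] config_restrict_in_configs[of c d S "S - X"] by auto
qed simp

lemma enc_insert:
  assumes "finite X" "\<forall>p\<in>X. p < b" "d > 0"
  shows "enc d (insert b X) k = (enc d X (k mod d ^ card X))(b := k div d ^ card X mod d)"
proof
  fix p
  consider "p = b" | "p \<in> X" | "p \<noteq> b" "p \<notin> X"
    by blast
  then show "enc d (insert b X) k p = ((enc d X (k mod d ^ card X))(b := k div d ^ card X mod d)) p"
  proof cases
    case 1
    then have "{q \<in> insert b X. q < p} = X"
      using assms by auto
    then show ?thesis
      using 1 by (simp add: enc_def)
  next
    case 2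
    let ?r = "card {q \<in> X. q < p}"
    have "?r < card X"
      using 2 assms by (intro psubset_card_mono) auto
    then obtain j where "card X = ?r + Suc j"
      using less_imp_Suc_add by fastforce
    then have "d ^ card X = d ^ ?r * (d * d ^ j)"
      by (simp add: power_add)
    then have "k mod d ^ card X div d ^ ?r = k div d ^ ?r mod (d * d ^ j)"
      using \<open>d > 0\<close> by (simp only: mod_mult2_eq) simp
    then have "k mod d ^ card X div d ^ ?r mod d = k div d ^ ?r mod d"
      by (simp add: mod_mod_cancel)
    moreover have "{q \<in> insert b X. q < p} = {q \<in> X. q < p}" "p \<noteq> b"
      using 2 assms by force+
    ultimately show ?thesis
      using 2 by (simp add: enc_def)
  qed (simp add: enc_def)
qed

lemma enc_in_configs: "d > 0 \<Longrightarrow> enc d X k \<in> configs d X"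
  by (simp add: configs_def enc_def)

lemma sum_lessThan_mult_div_mod:
  fixes m d :: nat
  shows "(\<Sum>k<m * d. f (k mod m) (k div m)) = (\<Sum>i<m. \<Sum>x<d. f i x)"
proof -
  have "(\<Sum>k<m * d. f (k mod m) (k div m)) = (\<Sum>x<d. \<Sum>k\<in>{x * m..<x * m + m}. f (k mod m) (k div m))"
    by (simp add: sum.nat_group mult.commute)
  also have "\<dots> = (\<Sum>x<d. \<Sum>i<m. f i x)"
  proof (rule sum.cong[OF refl])
    fix x
    show "(\<Sum>k\<in>{x * m..<x * m + m}. f (k mod m) (k div m)) = (\<Sum>i<m. f i x)"
      by (rule sum.reindex_bij_witness[where i="\<lambda>i. x * m + i" and j="\<lambda>k. k - x * m"])
        (auto simp: nat_le_iff_add)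
  qed
  also have "\<dots> = (\<Sum>i<m. \<Sum>x<d. f i x)"
    by (rule sum.swap)
  finally show ?thesis .
qed

lemma sum_enc:
  assumes "finite X" "d > 0"
  shows "(\<Sum>k<d ^ card X. f (enc d X k)) = sum f (configs d X)"
  using assms(1)
proof (induction X arbitrary: f rule: finite_linorder_max_induct)
  case empty
  have "enc d {} 0 = 0"
    by (simp add: enc_def fun_eq_iff)
  then show ?case
    by simp
next
  case (insert b X)
  then have "b \<notin> X"
    by blast
  let ?D = "d ^ card X"
  have "(\<Sum>k<d ^ card (insert b X). f (enc d (insert b X) k))
    = (\<Sum>k<?D * d. f ((enc d X (k mod ?D))(b := k div ?D)))"
  proof (rule sum.cong)
    fix k assume "k \<in> {..<?D * d}"
    then have "k div ?D < d"
      by (simp add: less_mult_imp_div_less mult.commute)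
    then show "f (enc d (insert b X) k) = f ((enc d X (k mod ?D))(b := k div ?D))"
      using insert \<open>d > 0\<close> by (simp add: enc_insert)
  qed (use insert \<open>b \<notin> X\<close> in simp)
  also have "\<dots> = (\<Sum>i<?D. \<Sum>x<d. f ((enc d X i)(b := x)))"
    by (rule sum_lessThan_mult_div_mod)
  also have "\<dots> = sum f (configs d (insert b X))"
    using insert.IH[of "\<lambda>c. \<Sum>x<d. f (c(b := x))"] by (simp add: sum_configs_insert[OF \<open>b \<notin> X\<close>])
  finally show ?case .
qed

section \<open>Entropy of reduced states\<close>

definition reduced_kernel ::
  "nat \<Rightarrow> nat \<Rightarrow> ((nat \<Rightarrow> nat) \<Rightarrow> complex) \<Rightarrow> nat set \<Rightarrow> (nat \<Rightarrow> nat) \<Rightarrow> (nat \<Rightarrow> nat) \<Rightarrow> complex" where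
  "reduced_kernel d N psi X = gram_kernel (configs d ({0..<N} - X)) (\<lambda>k a. psi (a + k))"

lemma reduced_eq_reduced_kernel:
  assumes "d > 0"
  shows "reduced d N psi X
    = mat (d ^ card X) (d ^ card X) (\<lambda>(i, j). reduced_kernel d N psi X (enc d X i) (enc d X j))"
proof -
  let ?Y = "{0..<N} - X"
  have "(\<Sum>k<d ^ card ?Y. psi (\<lambda>p. a p + enc d ?Y k p) * cnj (psi (\<lambda>p. c p + enc d ?Y k p)))
    = reduced_kernel d N psi X a c" for a c
    using sum_enc[of ?Y d "\<lambda>k. psi (a + k) * cnj (psi (c + k))"] assms
    by (simp add: reduced_kernel_def gram_kernel_def plus_fun_def)
  then show ?thesis
    by (simp add: reduced_def Let_def)
qed

lemma reduced_eq_gram_kernel: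
  assumes "d > 0"
  shows "reduced d N psi X = mat (d ^ card X) (d ^ card X)
    (\<lambda>(i, j). gram_kernel (configs d ({0..<N} - X)) (\<lambda>k i. psi (enc d X i + k)) i j)"
  by (simp add: reduced_eq_reduced_kernel[OF assms] reduced_kernel_def gram_kernel_def)

lemma sum_enc_filter:
  assumes "finite X" "d > 0"
  shows "(\<Sum>i | i < d ^ card X \<and> P (enc d X i). f (enc d X i)) = (\<Sum>a | a \<in> configs d X \<and> P a. f a)"
proof -
  have "(\<Sum>i | i \<in> {..<d ^ card X} \<and> P (enc d X i). f (enc d X i)) = (\<Sum>a | a \<in> configs d X \<and> P a. f a)"
    using sum_enc[OF assms, of "\<lambda>a. if P a then f a else 0"] assms(1)
    by (simp only: sum.inter_filter finite_lessThan finite_configs)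
  then show ?thesis
    by simp
qed

lemma ent_le_diagonal_entropy:
  assumes "d > 1" "finite X"
  shows "ent d N psi X \<le> shannon_entropy d (configs d X) (\<lambda>a. Re (reduced_kernel d N psi X a a))"
proof -
  let ?p = "\<lambda>a. \<Sum>k\<in>configs d ({0..<N} - X). (cmod (psi (a + k)))\<^sup>2"
  have "ent d N psi X \<le> shannon_entropy d {..<d ^ card X} (\<lambda>i. ?p (enc d X i))"
    unfolding ent_def using assms by (simp add: reduced_eq_gram_kernel vn_entropy_le_diagonal_entropy)
  also have "\<dots> = shannon_entropy d (configs d X) ?p"
    using sum_enc[OF assms(2), of d "\<lambda>a. ?p a * log d (?p a)"] assms(1) by (simp add: shannon_entropy_def)
  finally show ?thesis
    by (simp add: reduced_kernel_def gram_kernel_diag)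
qed

lemma ent_ge_block_entropy:
  assumes "d > 1" "finite X" "finite J" and f: "\<And>a. a \<in> configs d X \<Longrightarrow> f a \<in> J"
    and block: "\<And>a c. a \<in> configs d X \<Longrightarrow> c \<in> configs d X \<Longrightarrow> f a \<noteq> f c \<Longrightarrow>
      reduced_kernel d N psi X a c = 0"
  shows "shannon_entropy d J (\<lambda>y. \<Sum>a | a \<in> configs d X \<and> f a = y. Re (reduced_kernel d N psi X a a))
    \<le> ent d N psi X"
proof -
  let ?K = "configs d ({0..<N} - X)"
  have "d > 0"
    using \<open>d > 1\<close> by simp
  have "shannon_entropy d J
      (\<lambda>y. \<Sum>i | i < d ^ card X \<and> f (enc d X i) = y. \<Sum>k\<in>?K. (cmod (psi (enc d X i + k)))\<^sup>2)
    \<le> ent d N psi X"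
    unfolding ent_def reduced_eq_gram_kernel[OF \<open>d > 0\<close>]
  proof (rule vn_entropy_ge_block_entropy)
    fix i j assume "f (enc d X i) \<noteq> f (enc d X j)"
    then show "gram_kernel ?K (\<lambda>k i. psi (enc d X i + k)) i j = 0"
      using block[of "enc d X i" "enc d X j"] assms(1) enc_in_configs
      by (simp add: reduced_kernel_def gram_kernel_def)
  qed (use assms enc_in_configs in auto)
  then show ?thesis
    using assms(1,2)
    by (simp add: sum_enc_filter[where f="\<lambda>a. \<Sum>k\<in>?K. (cmod (psi (a + k)))\<^sup>2" and P="\<lambda>a. f a = _"]
        reduced_kernel_def gram_kernel_diag)
qed

lemma ent_diagonal:
  assumes "d > 1" "finite X"
    and "\<And>a c. a \<in> configs d X \<Longrightarrow> c \<in> configs d X \<Longrightarrow> a \<noteq> c \<Longrightarrow> reduced_kernel d N psi X a c = 0"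
  shows "ent d N psi X = shannon_entropy d (configs d X) (\<lambda>a. Re (reduced_kernel d N psi X a a))"
proof (rule antisym[OF ent_le_diagonal_entropy])
  have "{a \<in> configs d X. a = y} = {y}" if "y \<in> configs d X" for y
    using that by auto
  then show "shannon_entropy d (configs d X) (\<lambda>a. Re (reduced_kernel d N psi X a a)) \<le> ent d N psi X"
    using ent_ge_block_entropy[of d X "configs d X" "\<lambda>a. a" N psi] assms
    by (simp add: shannon_entropy_def)
qed (use assms in auto)

lemma ent_pure_blocks:
  assumes "d > 0" "finite X" "finite J" and f: "\<And>a. a \<in> configs d X \<Longrightarrow> f a \<in> J"
    and pure: "\<And>a c. a \<in> configs d X \<Longrightarrow> c \<in> configs d X \<Longrightarrow>
      reduced_kernel d N psi X a c = (if f a = f c then g a * cnj (g c) else 0)"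
  shows "ent d N psi X = shannon_entropy d J (\<lambda>y. \<Sum>a | a \<in> configs d X \<and> f a = y. (cmod (g a))\<^sup>2)"
proof -
  define w where "w = (\<lambda>y a. if f a = y then g a else 0)"
  have "reduced_kernel d N psi X a c = gram_kernel J w a c" if "a \<in> configs d X" "c \<in> configs d X" for a c
  proof -
    have "gram_kernel J w a c = (\<Sum>y\<in>J. if f a = y then if f c = y then g a * cnj (g c) else 0 else 0)"
      unfolding gram_kernel_def w_def by (intro sum.cong) auto
    then show ?thesis
      using f[OF that(1)] \<open>finite J\<close> pure[OF that] by (auto simp: eq_commute)
  qed
  then have "reduced d N psi X
    = mat (d ^ card X) (d ^ card X) (\<lambda>(i, j). gram_kernel J (\<lambda>y i. w y (enc d X i)) i j)"
    using enc_in_configs[OF \<open>d > 0\<close>] unfolding reduced_eq_reduced_kernel[OF \<open>d > 0\<close>]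
    by (intro eq_matI) (auto simp: gram_kernel_def)
  moreover have "cinner (d ^ card X) (\<lambda>i. w x (enc d X i)) (\<lambda>i. w y (enc d X i))
    = (if x = y then of_real (\<Sum>a | a \<in> configs d X \<and> f a = x. (cmod (g a))\<^sup>2) else 0)" for x y
  proof -
    have "cinner (d ^ card X) (\<lambda>i. w x (enc d X i)) (\<lambda>i. w y (enc d X i))
      = (\<Sum>a\<in>configs d X. cnj (w x a) * w y a)"
      unfolding cinner_def by (rule sum_enc[OF \<open>finite X\<close> \<open>d > 0\<close>])
    also have "\<dots> = (\<Sum>a\<in>configs d X. if f a = x then if x = y then of_real ((cmod (g a))\<^sup>2) else 0 else 0)"
      by (intro sum.cong) (auto simp: w_def complex_norm_square mult.commute simp del: of_real_power)
    also have "\<dots> = (\<Sum>a | a \<in> configs d X \<and> f a = x. if x = y then of_real ((cmod (g a))\<^sup>2) else 0)"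
      using \<open>finite X\<close> by (simp only: sum.inter_filter finite_configs)
    finally show ?thesis
      by simp
  qed
  ultimately show ?thesis
    unfolding ent_def using \<open>finite J\<close> by (simp add: vn_entropy_orthogonal_gram)
qed

section \<open>Consecutive measurements\<close>

lemma Umat_eq_cinner: "Umat d b i x y = cinner d (b i y) (b (i - 1) x)"
  by (simp add: Umat_def cinner_def)

lemma Umat_rows_orthonormal:
  assumes "orthonormal d d (b (i - 1))" "orthonormal d d (b i)" "x < d" "y < d"
  shows "(\<Sum>z<d. Umat d b i x z * cnj (Umat d b i y z)) = (if x = y then 1 else 0)"
  using assms by (simp add: Umat_eq_cinner orthonormal_parseval orthonormal_eq)

locale consecutive_measurements =
  fixes d n :: nat and \<alpha> :: "nat \<Rightarrow> complex" and b :: "nat \<Rightarrow> nat \<Rightarrow> nat \<Rightarrow> complex"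
  assumes d_gt_1: "d > 1" and n_ge_2: "n \<ge> 2"
    and basis: "i \<in> {1..n} \<Longrightarrow> orthonormal d d (b i)"
begin

declare One_nat_def [simp del]

abbreviation N :: nat where "N \<equiv> 2 * n + 1"

abbreviation \<psi>\<^sub>u :: "(nat \<Rightarrow> nat) \<Rightarrow> complex" where "\<psi>\<^sub>u \<equiv> unamplified d n \<alpha> b"

abbreviation \<psi>\<^sub>a :: "(nat \<Rightarrow> nat) \<Rightarrow> complex" where "\<psi>\<^sub>a \<equiv> amplified d n \<alpha> b"

definition path_amp :: "nat \<Rightarrow> (nat \<Rightarrow> nat) \<Rightarrow> complex" where
  "path_amp m c = \<alpha> (c 1) * (\<Prod>i\<in>{2..m}. Umat d b i (c (i - 1)) (c i))"

lemma d_pos: "d > 0"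
  using d_gt_1 by simp

lemma path_amp_cong:
  assumes "m \<ge> 1" "\<And>i. i \<in> {1..m} \<Longrightarrow> c i = c' i"
  shows "path_amp m c = path_amp m c'"
proof -
  have "c 1 = c' 1"
    using assms by simp
  moreover have "Umat d b i (c (i - 1)) (c i) = Umat d b i (c' (i - 1)) (c' i)" if "i \<in> {2..m}" for i
    using that by (intro arg_cong2[where f="Umat d b i"] assms(2)) auto
  ultimately show ?thesis
    by (simp add: path_amp_def)
qed

lemma path_amp_last: "path_amp n c = path_amp (n - 1) c * Umat d b n (c (n - 1)) (c n)"
proof -
  have "{2..n} = insert n {2..n - 1}" "n \<notin> {2..n - 1}"
    using n_ge_2 by auto
  then show ?thesis
    by (simp add: path_amp_def ac_simps)
qed

lemma path_amp_fun_upd_last: "path_amp n (c(n := y)) = path_amp (n - 1) c * Umat d b n (c (n - 1)) y"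
proof -
  have "path_amp (n - 1) (c(n := y)) = path_amp (n - 1) c"
    using n_ge_2 by (intro path_amp_cong) auto
  moreover have "n - 1 \<noteq> n"
    using n_ge_2 by auto
  ultimately show ?thesis
    unfolding path_amp_last[of "c(n := y)"] by simp
qed

lemma amp_eq_path_amp: "amp d n \<alpha> b c = path_amp n c * b n (c n) (c 0)"
  by (simp add: amp_def path_amp_def)

lemma last_basis_orthonormal: "x < d \<Longrightarrow> y < d \<Longrightarrow> (\<Sum>q<d. b n x q * cnj (b n y q)) = (if x = y then 1 else 0)"
  using orthonormal_eq[OF basis[of n], of y x] n_ge_2 by (simp add: cinner_def mult.commute)

lemma transition_rows_orthonormal:
  "x < d \<Longrightarrow> y < d \<Longrightarrow> (\<Sum>z<d. Umat d b n x z * cnj (Umat d b n y z)) = (if x = y then 1 else 0)"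
  using n_ge_2 by (intro Umat_rows_orthonormal basis) auto

definition transition_prob :: "nat \<Rightarrow> nat \<Rightarrow> real" where
  "transition_prob x y = (cmod (Umat d b n x y))\<^sup>2"

lemma transition_prob_nonneg: "transition_prob x y \<ge> 0"
  by (simp add: transition_prob_def)

lemma sum_transition_prob:
  assumes "x < d"
  shows "(\<Sum>y<d. transition_prob x y) = 1"
proof -
  have "complex_of_real (\<Sum>y<d. transition_prob x y) = 1"
    using transition_rows_orthonormal[OF assms assms]
    by (simp add: transition_prob_def complex_norm_square del: of_real_power)
  then show ?thesis
    unfolding of_real_eq_1_iff .
qed

lemma cmod_path_amp_fun_upd_last:
  "(cmod (path_amp n (c(n := y))))\<^sup>2 = (cmod (path_amp (n - 1) c))\<^sup>2 * transition_prob (c (n - 1)) y"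
  by (simp add: path_amp_fun_upd_last transition_prob_def norm_mult power_mult_distrib)

subsection \<open>Distribution of the measurement outcomes\<close>

definition outcome_prob :: "nat set \<Rightarrow> (nat \<Rightarrow> nat) \<Rightarrow> real" where
  "outcome_prob X a = (\<Sum>c | c \<in> configs d {1..n} \<and> config_restrict X c = a. (cmod (path_amp n c))\<^sup>2)"

definition outcome_entropy :: "nat set \<Rightarrow> real" where
  "outcome_entropy X = shannon_entropy d (configs d X) (outcome_prob X)"

lemma outcome_prob_nonneg: "outcome_prob X a \<ge> 0"
  by (simp add: outcome_prob_def sum_nonneg)

lemma outcome_prob_eq_sum:
  assumes "X \<subseteq> {1..n}" "a \<in> configs d X"
  shows "outcome_prob X a = (\<Sum>r\<in>configs d ({1..n} - X). (cmod (path_amp n (a + r)))\<^sup>2)"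
  unfolding outcome_prob_def by (rule sum_configs_fiber[OF assms, symmetric])

lemma outcome_expectation:
  assumes "X \<subseteq> {1..n}"
  shows "(\<Sum>a\<in>configs d X. outcome_prob X a * F a)
    = (\<Sum>c\<in>configs d {1..n}. (cmod (path_amp n c))\<^sup>2 * F (config_restrict X c))"
proof -
  have "(\<Sum>a\<in>configs d X. outcome_prob X a * F a)
    = (\<Sum>a\<in>configs d X. \<Sum>c | c \<in> configs d {1..n} \<and> config_restrict X c = a.
        (cmod (path_amp n c))\<^sup>2 * F (config_restrict X c))"
    by (simp add: outcome_prob_def sum_distrib_right)
  also have "\<dots> = (\<Sum>c\<in>configs d {1..n}. (cmod (path_amp n c))\<^sup>2 * F (config_restrict X c))"
    using assms finite_subset[OF assms] config_restrict_in_configs[OF _ assms] by (intro sum.group) auto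
  finally show ?thesis .
qed

lemma outcome_prob_marginal:
  assumes "Y \<subseteq> X" "X \<subseteq> {1..n}"
  shows "(\<Sum>a | a \<in> configs d X \<and> config_restrict Y a = y. outcome_prob X a) = outcome_prob Y y"
proof -
  have "finite (configs d X)"
    using finite_subset[OF assms(2)] by simp
  then have "(\<Sum>a | a \<in> configs d X \<and> config_restrict Y a = y. outcome_prob X a)
    = (\<Sum>a\<in>configs d X. outcome_prob X a * (if config_restrict Y a = y then 1 else 0))"
    by (simp add: sum.inter_filter if_distrib cong: if_cong)
  also have "\<dots> = outcome_prob Y y"
    unfolding outcome_expectation[OF assms(2)] config_restrict_restrict[OF assms(1)]
    by (simp add: outcome_prob_def sum.inter_filter if_distrib cong: if_cong)
  finally show ?thesis .
qed

lemma outcome_prob_before_last: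
  assumes "Y \<subseteq> {1..n - 1}" "a \<in> configs d Y"
  shows "outcome_prob Y a = (\<Sum>r\<in>configs d ({1..n - 1} - Y). (cmod (path_amp (n - 1) (a + r)))\<^sup>2)"
proof -
  have "Y \<subseteq> {1..n}"
    using assms(1) by (rule order_trans) auto
  moreover have "n \<notin> Y" "{1..n} - Y = insert n ({1..n - 1} - Y)"
    using assms(1) n_ge_2 by auto
  ultimately have "outcome_prob Y a
    = (\<Sum>r\<in>configs d ({1..n - 1} - Y). \<Sum>y<d. (cmod (path_amp n (a + r(n := y))))\<^sup>2)"
    using n_ge_2 by (simp add: outcome_prob_eq_sum assms(2) sum_configs_insert)
  also have "\<dots> = (\<Sum>r\<in>configs d ({1..n - 1} - Y). (cmod (path_amp (n - 1) (a + r)))\<^sup>2)"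
  proof (rule sum.cong[OF refl])
    fix r assume r: "r \<in> configs d ({1..n - 1} - Y)"
    have "a + r(n := y) = (a + r)(n := y)" for y
      using configs_eq_0[OF assms(2) \<open>n \<notin> Y\<close>] by auto
    moreover have "(a + r) (n - 1) < d"
      using configs_less[OF configs_add(1)[OF assms(2) r assms(1)], of "n - 1"] n_ge_2 by simp
    ultimately show "(\<Sum>y<d. (cmod (path_amp n (a + r(n := y))))\<^sup>2) = (cmod (path_amp (n - 1) (a + r)))\<^sup>2"
      by (simp add: cmod_path_amp_fun_upd_last sum_transition_prob del: plus_fun_apply
          flip: sum_distrib_left)
  qed
  finally show ?thesis .
qed

lemma outcome_prob_Markov:
  assumes "Y \<subseteq> {1..n - 1}" "n - 1 \<in> Y" "a \<in> configs d Y" "y < d"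
  shows "outcome_prob (insert n Y) (a(n := y)) = outcome_prob Y a * transition_prob (a (n - 1)) y"
proof -
  have "Y \<subseteq> {1..n}"
    using assms(1) by (rule order_trans) auto
  then have "insert n Y \<subseteq> {1..n}" and rest: "{1..n} - insert n Y = {1..n - 1} - Y" and "n \<notin> Y"
    using assms(1) n_ge_2 by auto
  have "a(n := y) \<in> configs d (insert n Y)"
    using assms(3,4) by (auto simp: configs_def)
  then have "outcome_prob (insert n Y) (a(n := y))
    = (\<Sum>r\<in>configs d ({1..n - 1} - Y). (cmod (path_amp n (a(n := y) + r)))\<^sup>2)"
    using \<open>insert n Y \<subseteq> {1..n}\<close> by (simp only: outcome_prob_eq_sum rest)
  also have "\<dots> = (\<Sum>r\<in>configs d ({1..n - 1} - Y).
      (cmod (path_amp (n - 1) (a + r)))\<^sup>2 * transition_prob (a (n - 1)) y)"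
  proof (rule sum.cong[OF refl])
    fix r assume r: "r \<in> configs d ({1..n - 1} - Y)"
    have "r n = 0" "r (n - 1) = 0"
      using assms(2) n_ge_2 by (auto intro!: configs_eq_0[OF r])
    then have "a(n := y) + r = (a + r)(n := y)" "(a + r) (n - 1) = a (n - 1)"
      by auto
    then show "(cmod (path_amp n (a(n := y) + r)))\<^sup>2
      = (cmod (path_amp (n - 1) (a + r)))\<^sup>2 * transition_prob (a (n - 1)) y"
      by (simp only: cmod_path_amp_fun_upd_last)
  qed
  also have "\<dots> = outcome_prob Y a * transition_prob (a (n - 1)) y"
    unfolding outcome_prob_before_last[OF assms(1,3)] sum_distrib_right ..
  finally show ?thesis .
qed

definition transition_entropy :: real where
  "transition_entropy = (\<Sum>c\<in>configs d {1..n}.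
    (cmod (path_amp n c))\<^sup>2 * shannon_entropy d {..<d} (transition_prob (c (n - 1))))"

lemma outcome_entropy_insert_last:
  assumes "Y \<subseteq> {1..n - 1}" "n - 1 \<in> Y"
  shows "outcome_entropy (insert n Y) = outcome_entropy Y + transition_entropy"
proof -
  let ?W = "\<lambda>a. transition_prob (a (n - 1))"
  have "Y \<subseteq> {1..n}"
    using assms(1) by (rule order_trans) auto
  have "n \<notin> Y"
    using assms(1) n_ge_2 by auto
  have "outcome_entropy (insert n Y)
    = shannon_entropy d (configs d Y \<times> {..<d}) (\<lambda>(a, y). outcome_prob Y a * ?W a y)"
    unfolding outcome_entropy_def
      shannon_entropy_reindex_bij_betw[OF bij_betw_configs_insert[OF \<open>n \<notin> Y\<close>], symmetric]
    using assms by (intro shannon_entropy_cong) (auto simp: outcome_prob_Markov)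
  also have "\<dots> = outcome_entropy Y + (\<Sum>a\<in>configs d Y. outcome_prob Y a * shannon_entropy d {..<d} (?W a))"
    unfolding outcome_entropy_def using assms(2)
    by (intro shannon_entropy_chain_rule)
      (auto simp: outcome_prob_nonneg transition_prob_nonneg sum_transition_prob configs_less)
  also have "(\<Sum>a\<in>configs d Y. outcome_prob Y a * shannon_entropy d {..<d} (?W a)) = transition_entropy"
    unfolding outcome_expectation[OF \<open>Y \<subseteq> {1..n}\<close>] transition_entropy_def
    using assms(2) by (simp add: config_restrict_def)
  finally show ?thesis .
qed

subsection \<open>The unamplified state\<close>

lemma unamplified_fun_upd_Q:
  assumes "c \<in> configs d {1..n}"
  shows "\<psi>\<^sub>u (c(0 := x)) = path_amp n c * b n (c n) x"
proof -
  have "path_amp n (c(0 := x)) = path_amp n c"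
    using n_ge_2 by (intro path_amp_cong) auto
  moreover have "c (n + i) = 0" if "i \<in> {1..n}" for i
    using that by (intro configs_eq_0[OF assms]) auto
  ultimately show ?thesis
    using n_ge_2 by (simp add: unamplified_def amp_eq_path_amp)
qed

lemma unamplified_eq_0:
  assumes "p \<in> {n + 1..2 * n}" "c p \<noteq> 0"
  shows "\<psi>\<^sub>u c = 0"
proof -
  have "p - n \<in> {1..n}" "n + (p - n) = p"
    using assms(1) by auto
  then show ?thesis
    using assms(2) unfolding unamplified_def by (metis (full_types))
qed

lemma unamplified_trace_Q:
  assumes c: "c \<in> configs d {1..n}" and e: "e \<in> configs d {1..n}"
  shows "(\<Sum>x<d. \<psi>\<^sub>u (c(0 := x)) * cnj (\<psi>\<^sub>u (e(0 := x))))
    = (if c n = e n then path_amp n c * cnj (path_amp n e) else 0)"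
proof -
  have basis: "(\<Sum>x<d. b n (c n) x * cnj (b n (e n) x)) = (if c n = e n then 1 else 0)"
    using n_ge_2 by (intro last_basis_orthonormal configs_less[OF c] configs_less[OF e]) auto
  have "(\<Sum>x<d. \<psi>\<^sub>u (c(0 := x)) * cnj (\<psi>\<^sub>u (e(0 := x))))
    = path_amp n c * cnj (path_amp n e) * (\<Sum>x<d. b n (c n) x * cnj (b n (e n) x))"
    unfolding unamplified_fun_upd_Q[OF c] unamplified_fun_upd_Q[OF e]
    by (simp add: sum_distrib_left mult_ac)
  then show ?thesis
    unfolding basis by simp
qed

lemma unamplified_trace_detectors:
  assumes "X \<subseteq> {1..n}"
  shows "reduced_kernel d N \<psi>\<^sub>u X a c
    = (\<Sum>k\<in>configs d (insert 0 ({1..n} - X)). \<psi>\<^sub>u (a + k) * cnj (\<psi>\<^sub>u (c + k)))"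
  unfolding reduced_kernel_def gram_kernel_def
proof (rule sum.mono_neutral_right)
  have sub: "insert 0 ({1..n} - X) \<subseteq> {0..<N} - X"
    using assms by auto
  then show "configs d (insert 0 ({1..n} - X)) \<subseteq> configs d ({0..<N} - X)"
    using d_pos by (intro configs_mono)
  show "\<forall>k\<in>configs d ({0..<N} - X) - configs d (insert 0 ({1..n} - X)). \<psi>\<^sub>u (a + k) * cnj (\<psi>\<^sub>u (c + k)) = 0"
  proof
    fix k assume "k \<in> configs d ({0..<N} - X) - configs d (insert 0 ({1..n} - X))"
    then obtain p where "p \<in> ({0..<N} - X) - insert 0 ({1..n} - X)" "k p \<noteq> 0"
      using sub by (rule configs_Diff_nonzero)
    then have "\<psi>\<^sub>u (a + k) = 0"
      by (intro unamplified_eq_0[of p]) auto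
    then show "\<psi>\<^sub>u (a + k) * cnj (\<psi>\<^sub>u (c + k)) = 0"
      by simp
  qed
qed simp

lemma reduced_kernel_unamplified:
  assumes X: "X \<subseteq> {1..n}" and a: "a \<in> configs d X" and c: "c \<in> configs d X"
  shows "reduced_kernel d N \<psi>\<^sub>u X a c
    = (if a n = c n then \<Sum>r\<in>configs d ({1..n} - X). path_amp n (a + r) * cnj (path_amp n (c + r)) else 0)"
proof -
  let ?R = "{1..n} - X"
  have zero: "a 0 = 0" "c 0 = 0"
    using X by (auto intro!: configs_eq_0[OF a] configs_eq_0[OF c])
  have "reduced_kernel d N \<psi>\<^sub>u X a c
    = (\<Sum>r\<in>configs d ?R. \<Sum>x<d. \<psi>\<^sub>u (a + r(0 := x)) * cnj (\<psi>\<^sub>u (c + r(0 := x))))"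
    unfolding unamplified_trace_detectors[OF X] by (rule sum_configs_insert) auto
  also have "\<dots> = (\<Sum>r\<in>configs d ?R. if a n = c n then path_amp n (a + r) * cnj (path_amp n (c + r)) else 0)"
  proof (rule sum.cong[OF refl])
    fix r assume r: "r \<in> configs d ?R"
    have upd: "a + r(0 := x) = (a + r)(0 := x)" "c + r(0 := x) = (c + r)(0 := x)" for x
      using zero by auto
    show "(\<Sum>x<d. \<psi>\<^sub>u (a + r(0 := x)) * cnj (\<psi>\<^sub>u (c + r(0 := x))))
      = (if a n = c n then path_amp n (a + r) * cnj (path_amp n (c + r)) else 0)"
      unfolding upd unamplified_trace_Q[OF configs_add(1)[OF a r X] configs_add(1)[OF c r X]] by simp
  qed
  finally show ?thesis
    by simp
qed

lemma reduced_kernel_unamplified_diag: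
  assumes "X \<subseteq> {1..n}" "a \<in> configs d X"
  shows "reduced_kernel d N \<psi>\<^sub>u X a a = of_real (outcome_prob X a)"
  by (simp add: reduced_kernel_unamplified assms outcome_prob_eq_sum complex_norm_square del: of_real_power)

lemma ent_unamplified_le_outcome_entropy:
  assumes "X \<subseteq> {1..n}"
  shows "ent d N \<psi>\<^sub>u X \<le> outcome_entropy X"
  using ent_le_diagonal_entropy[of d X N \<psi>\<^sub>u] d_gt_1 finite_subset[OF assms]
  by (simp add: outcome_entropy_def reduced_kernel_unamplified_diag[OF assms] cong: shannon_entropy_cong)

lemma ent_unamplified_ge_last_outcome_entropy:
  assumes X: "X \<subseteq> {1..n}" "n \<in> X"
  shows "outcome_entropy {n} \<le> ent d N \<psi>\<^sub>u X"
proof -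
  let ?f = "config_restrict {n}"
  have "shannon_entropy d (configs d {n})
      (\<lambda>y. \<Sum>a | a \<in> configs d X \<and> ?f a = y. Re (reduced_kernel d N \<psi>\<^sub>u X a a))
    \<le> ent d N \<psi>\<^sub>u X"
  proof (rule ent_ge_block_entropy)
    show "?f a \<in> configs d {n}" if "a \<in> configs d X" for a
      using that X by (intro config_restrict_in_configs) auto
    show "reduced_kernel d N \<psi>\<^sub>u X a c = 0" if "a \<in> configs d X" "c \<in> configs d X" "?f a \<noteq> ?f c" for a c
      using that X by (simp add: reduced_kernel_unamplified config_restrict_eq_iff)
  qed (use d_gt_1 finite_subset[OF X(1)] in auto)
  then show ?thesis
    using X outcome_prob_marginal[of "{n}" X]
    by (simp add: outcome_entropy_def reduced_kernel_unamplified_diag[OF X(1)])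
qed

lemma ent_unamplified_last: "ent d N \<psi>\<^sub>u {n} = outcome_entropy {n}"
  using n_ge_2
  by (intro antisym ent_unamplified_le_outcome_entropy ent_unamplified_ge_last_outcome_entropy) auto

lemma ent_unamplified_all: "ent d N \<psi>\<^sub>u {1..n} = outcome_entropy {n}"
proof -
  let ?f = "config_restrict {n}"
  have "ent d N \<psi>\<^sub>u {1..n}
    = shannon_entropy d (configs d {n}) (\<lambda>y. \<Sum>a | a \<in> configs d {1..n} \<and> ?f a = y. (cmod (path_amp n a))\<^sup>2)"
  proof (rule ent_pure_blocks)
    show "?f a \<in> configs d {n}" if "a \<in> configs d {1..n}" for a
      using that n_ge_2 by (intro config_restrict_in_configs) auto
    show "reduced_kernel d N \<psi>\<^sub>u {1..n} a c = (if ?f a = ?f c then path_amp n a * cnj (path_amp n c) else 0)"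
      if "a \<in> configs d {1..n}" "c \<in> configs d {1..n}" for a c
      using that by (simp add: reduced_kernel_unamplified config_restrict_eq_iff)
  qed (use d_pos in auto)
  also have "\<dots> = outcome_entropy {n}"
    unfolding outcome_entropy_def by (intro shannon_entropy_cong) (simp add: outcome_prob_def)
  finally show ?thesis .
qed

lemma reduced_kernel_unamplified_before_last:
  assumes a: "a \<in> configs d {1..n - 1}" and c: "c \<in> configs d {1..n - 1}"
  shows "reduced_kernel d N \<psi>\<^sub>u {1..n - 1} a c
    = (if a (n - 1) = c (n - 1) then path_amp (n - 1) a * cnj (path_amp (n - 1) c) else 0)"
proof -
  have sub: "{1..n - 1} \<subseteq> {1..n}" and rest: "{1..n} - {1..n - 1} = insert n {}"
    and zero: "a n = 0" "c n = 0"
    using n_ge_2 by (auto intro!: configs_eq_0[OF a] configs_eq_0[OF c])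
  have upd: "a + 0(n := y) = a(n := y)" "c + 0(n := y) = c(n := y)" for y
    using zero by auto
  have "reduced_kernel d N \<psi>\<^sub>u {1..n - 1} a c = path_amp (n - 1) a * cnj (path_amp (n - 1) c) *
      (\<Sum>y<d. Umat d b n (a (n - 1)) y * cnj (Umat d b n (c (n - 1)) y))"
    unfolding reduced_kernel_unamplified[OF sub a c] rest
    by (simp add: zero sum_configs_insert upd path_amp_fun_upd_last sum_distrib_left mult_ac)
  then show ?thesis
    using n_ge_2 by (simp add: transition_rows_orthonormal configs_less[OF a] configs_less[OF c])
qed

lemma ent_unamplified_before_last: "ent d N \<psi>\<^sub>u {1..n - 1} = outcome_entropy {n - 1}"
proof -
  let ?f = "config_restrict {n - 1}"
  have sub: "{n - 1} \<subseteq> {1..n - 1}"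
    using n_ge_2 by auto
  have "ent d N \<psi>\<^sub>u {1..n - 1} = shannon_entropy d (configs d {n - 1})
      (\<lambda>y. \<Sum>a | a \<in> configs d {1..n - 1} \<and> ?f a = y. (cmod (path_amp (n - 1) a))\<^sup>2)"
  proof (rule ent_pure_blocks)
    show "?f a \<in> configs d {n - 1}" if "a \<in> configs d {1..n - 1}" for a
      using that sub by (rule config_restrict_in_configs)
    show "reduced_kernel d N \<psi>\<^sub>u {1..n - 1} a c
      = (if ?f a = ?f c then path_amp (n - 1) a * cnj (path_amp (n - 1) c) else 0)"
      if "a \<in> configs d {1..n - 1}" "c \<in> configs d {1..n - 1}" for a c
      using that by (simp add: reduced_kernel_unamplified_before_last config_restrict_eq_iff)
  qed (use d_pos in auto)
  also have "\<dots> = outcome_entropy {n - 1}"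
    unfolding outcome_entropy_def
    by (intro shannon_entropy_cong)
      (simp add: outcome_prob_before_last[OF sub]
        sum_configs_fiber[OF sub, where f="\<lambda>c. (cmod (path_amp (n - 1) c))\<^sup>2"])
  finally show ?thesis .
qed

subsection \<open>The amplified state\<close>

definition copy_outcomes :: "(nat \<Rightarrow> nat) \<Rightarrow> nat \<Rightarrow> nat \<Rightarrow> nat" where
  "copy_outcomes c x p = (if p = 0 then x else if p \<le> n then c p else if p \<le> 2 * n then c (p - n) else 0)"

definition detector_outcomes :: "nat set \<Rightarrow> (nat \<Rightarrow> nat) \<Rightarrow> nat \<Rightarrow> nat" where
  "detector_outcomes T a = config_restrict T (\<lambda>i. a (n + i))"

definition copied_configs :: "(nat \<Rightarrow> nat) set" where
  "copied_configs = {e \<in> configs d {0..<N}. \<forall>i\<in>{1..n}. e (n + i) = e i}"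

lemma copy_outcomes_in_configs:
  assumes c: "c \<in> configs d {1..n}" and "x < d"
  shows "copy_outcomes c x \<in> configs d {0..<N}"
proof -
  have "c (p - n) < d" if "n < p" "p < N" for p
    using that by (intro configs_less[OF c]) auto
  then show ?thesis
    using \<open>x < d\<close> configs_less[OF c] by (auto simp: configs_def copy_outcomes_def)
qed

lemma bij_betw_copy_outcomes:
  "bij_betw (\<lambda>(c, x). copy_outcomes c x) (configs d {1..n} \<times> {..<d}) copied_configs"
proof (rule bij_betw_byWitness[where f'="\<lambda>e. (config_restrict {1..n} e, e 0)"])
  show "\<forall>cx\<in>configs d {1..n} \<times> {..<d}.
      (\<lambda>e. (config_restrict {1..n} e, e 0)) ((\<lambda>(c, x). copy_outcomes c x) cx) = cx"
    by (auto simp: copy_outcomes_def config_restrict_def fun_eq_iff configs_eq_0)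
  show "\<forall>e\<in>copied_configs.
      (\<lambda>(c, x). copy_outcomes c x) (config_restrict {1..n} e, e 0) = e"
  proof
    fix e assume e: "e \<in> copied_configs"
    have "copy_outcomes (config_restrict {1..n} e) (e 0) p = e p" for p
    proof (cases "n < p \<and> p \<le> 2 * n")
      case True
      then have "p - n \<in> {1..n}" "n + (p - n) = p"
        by auto
      then have "e (p - n) = e p"
        using e unfolding copied_configs_def by fastforce
      then show ?thesis
        using True by (auto simp: copy_outcomes_def config_restrict_def)
    next
      case False
      then show ?thesis
        using e by (auto simp: copied_configs_def copy_outcomes_def config_restrict_def configs_eq_0)
    qed
    then show "(\<lambda>(c, x). copy_outcomes c x) (config_restrict {1..n} e, e 0) = e"
      by auto
  qed
  show "(\<lambda>(c, x). copy_outcomes c x) ` (configs d {1..n} \<times> {..<d}) \<subseteq> copied_configs"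
    using copy_outcomes_in_configs by (auto simp: copied_configs_def copy_outcomes_def)
  show "(\<lambda>e. (config_restrict {1..n} e, e 0)) ` copied_configs \<subseteq> configs d {1..n} \<times> {..<d}"
    by (auto simp: copied_configs_def configs_less intro!: config_restrict_in_configs[of _ d "{0..<N}"])
qed

lemma bij_betw_detector_outcomes:
  "bij_betw (detector_outcomes T) (configs d ((+) n ` T)) (configs d T)"
  by (rule bij_betw_byWitness[where f'="\<lambda>t p. if p \<in> (+) n ` T then t (p - n) else 0"])
    (auto simp: detector_outcomes_def config_restrict_def configs_def fun_eq_iff)

lemma amplified_copy_outcomes: "\<psi>\<^sub>a (copy_outcomes c x) = path_amp n c * b n (c n) x"
proof -
  have "path_amp n (copy_outcomes c x) = path_amp n c"
    using n_ge_2 by (intro path_amp_cong) (auto simp: copy_outcomes_def)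
  then show ?thesis
    using n_ge_2 by (auto simp: amplified_def amp_eq_path_amp copy_outcomes_def)
qed

lemma reduced_kernel_amplified_offdiag:
  assumes T: "T \<subseteq> {1..n}" and a: "a \<in> configs d ((+) n ` T)" and c: "c \<in> configs d ((+) n ` T)" and "a \<noteq> c"
  shows "reduced_kernel d N \<psi>\<^sub>a ((+) n ` T) a c = 0"
  unfolding reduced_kernel_def gram_kernel_def
proof (rule sum.neutral, rule ballI)
  fix k assume k: "k \<in> configs d ({0..<N} - (+) n ` T)"
  obtain i where i: "i \<in> T" "a (n + i) \<noteq> c (n + i)"
    using \<open>a \<noteq> c\<close> configs_eq_0[OF a] configs_eq_0[OF c] by (metis ext imageE)
  have "i \<in> {1..n}"
    using i(1) T by blast
  then have "i \<notin> (+) n ` T"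
    using T by auto
  have "k (n + i) = 0"
    using i by (intro configs_eq_0[OF k]) auto
  moreover have "a i = 0" "c i = 0"
    using \<open>i \<notin> (+) n ` T\<close> by (auto intro: configs_eq_0[OF a] configs_eq_0[OF c])
  ultimately have "\<psi>\<^sub>a (a + k) = 0 \<or> \<psi>\<^sub>a (c + k) = 0"
    using i(2) \<open>i \<in> {1..n}\<close> unfolding amplified_def by (metis add.right_neutral add_0 plus_fun_apply)
  then show "\<psi>\<^sub>a (a + k) * cnj (\<psi>\<^sub>a (c + k)) = 0"
    by auto
qed

lemma reduced_kernel_amplified_diag:
  assumes T: "T \<subseteq> {1..n}" and a: "a \<in> configs d ((+) n ` T)"
  shows "reduced_kernel d N \<psi>\<^sub>a ((+) n ` T) a a = of_real (outcome_prob T (detector_outcomes T a))"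
proof -
  let ?X = "(+) n ` T"
  let ?t = "detector_outcomes T a"
  have restrict: "config_restrict ?X (copy_outcomes c x) = a \<longleftrightarrow> config_restrict T c = ?t" for c x
  proof -
    have "config_restrict ?X (copy_outcomes c x) = config_restrict ?X a \<longleftrightarrow> (\<forall>i\<in>T. c i = a (n + i))"
      using T by (auto simp: config_restrict_eq_iff copy_outcomes_def)
    then show ?thesis
      by (simp add: config_restrict_ident[OF a] detector_outcomes_def config_restrict_eq_iff)
  qed
  have "?X \<subseteq> {0..<N}"
    using T by auto
  then have "(\<Sum>k\<in>configs d ({0..<N} - ?X). (cmod (\<psi>\<^sub>a (a + k)))\<^sup>2)
    = (\<Sum>e | e \<in> configs d {0..<N} \<and> config_restrict ?X e = a. (cmod (\<psi>\<^sub>a e))\<^sup>2)"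
    using a by (rule sum_configs_fiber)
  also have "\<dots> = (\<Sum>e\<in>copied_configs. if config_restrict ?X e = a then (cmod (\<psi>\<^sub>a e))\<^sup>2 else 0)"
    by (rule sum.mono_neutral_cong) (auto simp: copied_configs_def amplified_def)
  also have "\<dots> = (\<Sum>(c, x)\<in>configs d {1..n} \<times> {..<d}.
      if config_restrict T c = ?t then (cmod (path_amp n c * b n (c n) x))\<^sup>2 else 0)"
    unfolding sum.reindex_bij_betw[OF bij_betw_copy_outcomes, symmetric]
    by (intro sum.cong refl) (simp add: restrict amplified_copy_outcomes split: prod.split)
  also have "\<dots> = (\<Sum>c\<in>configs d {1..n}. if config_restrict T c = ?t then (cmod (path_amp n c))\<^sup>2 else 0)"
    unfolding sum.cartesian_product[symmetric]
    using n_ge_2 orthonormal_sum_cmod[OF basis[of n]]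
    by (intro sum.cong) (auto simp: norm_mult power_mult_distrib configs_less simp flip: sum_distrib_left)
  also have "\<dots> = outcome_prob T ?t"
    by (simp add: outcome_prob_def sum.inter_filter)
  finally show ?thesis
    by (simp add: reduced_kernel_def gram_kernel_diag)
qed

lemma ent_detectors_eq_outcome_entropy:
  assumes "T \<subseteq> {1..n}"
  shows "ent d N \<psi>\<^sub>a ((+) n ` T) = outcome_entropy T"
proof -
  let ?X = "(+) n ` T"
  have "ent d N \<psi>\<^sub>a ?X = shannon_entropy d (configs d ?X) (\<lambda>a. Re (reduced_kernel d N \<psi>\<^sub>a ?X a a))"
    using d_gt_1 finite_subset[OF assms] reduced_kernel_amplified_offdiag[OF assms]
    by (intro ent_diagonal) auto
  also have "\<dots> = shannon_entropy d (configs d ?X) (\<lambda>a. outcome_prob T (detector_outcomes T a))"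
    by (intro shannon_entropy_cong) (simp add: reduced_kernel_amplified_diag[OF assms])
  also have "\<dots> = outcome_entropy T"
    unfolding outcome_entropy_def by (rule shannon_entropy_reindex_bij_betw[OF bij_betw_detector_outcomes])
  finally show ?thesis .
qed

lemma mutual_info_detectors:
  "mutual_info d N \<psi>\<^sub>a {2 * n} {n + 1..2 * n - 1} = outcome_entropy {n} - transition_entropy"
proof -
  have detectors: "{2 * n} = (+) n ` {n}" "{n + 1..2 * n - 1} = (+) n ` {1..n - 1}"
    and all: "(+) n ` {n} \<union> (+) n ` {1..n - 1} = (+) n ` {1..n}"
    using n_ge_2 by (auto simp: mult_2 simp flip: image_Un intro!: arg_cong[where f="(`) ((+) n)"])
  have "{1..n} = insert n {1..n - 1}"
    using n_ge_2 by auto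
  then have "outcome_entropy {1..n} = outcome_entropy {1..n - 1} + transition_entropy"
    using n_ge_2 by (simp only:) (intro outcome_entropy_insert_last, auto)
  moreover have "ent d N \<psi>\<^sub>a {2 * n} = outcome_entropy {n}"
    "ent d N \<psi>\<^sub>a {n + 1..2 * n - 1} = outcome_entropy {1..n - 1}"
    "ent d N \<psi>\<^sub>a ({2 * n} \<union> {n + 1..2 * n - 1}) = outcome_entropy {1..n}"
    unfolding detectors all by (rule ent_detectors_eq_outcome_entropy, use n_ge_2 in force)+
  ultimately show ?thesis
    by (simp add: mutual_info_def)
qed

lemma mutual_info_ancillae: "mutual_info d N \<psi>\<^sub>u {n} {1..n - 1} = outcome_entropy {n - 1}"
proof -
  have "{n} \<union> {1..n - 1} = {1..n}"
    using n_ge_2 by auto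
  then show ?thesis
    by (simp only: mutual_info_def ent_unamplified_last ent_unamplified_before_last ent_unamplified_all)
qed

lemma cond_ent_ancillae_le:
  "cond_ent d N \<psi>\<^sub>u {n - 1} {n} \<le> outcome_entropy {n - 1} + transition_entropy - outcome_entropy {n}"
proof -
  have "ent d N \<psi>\<^sub>u (insert n {n - 1}) \<le> outcome_entropy (insert n {n - 1})"
    using n_ge_2 by (intro ent_unamplified_le_outcome_entropy) auto
  also have "\<dots> = outcome_entropy {n - 1} + transition_entropy"
    using n_ge_2 by (intro outcome_entropy_insert_last) auto
  finally show ?thesis
    by (simp add: cond_ent_def ent_unamplified_last)
qed

lemma cond_ent_ancillae_nonneg: "cond_ent d N \<psi>\<^sub>u {n - 1} {n} \<ge> 0"
proof -
  have "outcome_entropy {n} \<le> ent d N \<psi>\<^sub>u ({n - 1} \<union> {n})"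
    using n_ge_2 by (intro ent_unamplified_ge_last_outcome_entropy) auto
  then show ?thesis
    by (simp add: cond_ent_def ent_unamplified_last)
qed

end

theorem theorem6:
  fixes d n :: nat and \<alpha> :: "nat \<Rightarrow> complex" and b :: "nat \<Rightarrow> nat \<Rightarrow> nat \<Rightarrow> complex"
  assumes "d \<ge> 2" and "n \<ge> 2"
    and orth: "\<forall>i\<in>{1..n}. \<forall>x<d. \<forall>y<d. (\<Sum>q<d. cnj (b i x q) * b i y q) = (if x = y then 1 else 0)"
    and norm: "(\<Sum>x<d. (cmod (\<alpha> x))\<^sup>2) = 1"
  shows "mutual_info d (2*n+1) (amplified d n \<alpha> b) {2*n} {n+1..2*n-1}
           \<le> mutual_info d (2*n+1) (unamplified d n \<alpha> b) {n} {1..n-1}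
              - cond_ent d (2*n+1) (unamplified d n \<alpha> b) {n-1} {n}
       \<and> cond_ent d (2*n+1) (unamplified d n \<alpha> b) {n-1} {n} \<ge> 0"
proof -
  interpret consecutive_measurements d n \<alpha> b
    using assms(1,2) orth by unfold_locales (auto simp: orthonormal_def cinner_def)
  show ?thesis
    using mutual_info_detectors mutual_info_ancillae cond_ent_ancillae_le cond_ent_ancillae_nonneg by simp
qed

end
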